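(* For any $\mu>0$ and $\rho>0$, the reduced barrier augmented Lagrangian function $\eta_\rho(\cdot,\cdot;\mu)$ is a nondegenerate $\mu$-self-concordant convex-concave function on $\hat{\mathbb E}\times\mathbb E$. Furthermore, $\eta_\rho(\cdot,s;\mu)$ is nondegenerate $\mu$-self-concordant on $\hat{\mathbb E}$ for every $s\in\mathbb E$, and $-\eta_\rho(\hat x,\cdot;\mu)$ is nondegenerate $\mu$-self-concordant on $\mathbb E$ for every $\hat x\in\hat{\mathbb E}$.
   Context: $(\mathbb E,\circ)$ is a Euclidean Jordan algebra of rank $\nu$ with inner product $\langle x,y\rangle=\operatorname{tr}(x\circ y)$, $\mathbb K$ its symmetric cone (cone of squares), and $\phi(z)=-\ln\det z$ on $\operatorname{int}(\mathbb K)$. $\mathcal A:\mathbb E\to\mathbb R^m$ is linear and surjective, $b\in\mathbb R^m$, $c\in\mathbb E$. Fix $\bar x\in\mathbb E$ with $\mathcal A\bar x=b$, a Euclidean space $\hat{\mathbb E}$ with $\dim\hat{\mathbb E}=\dim\ker\mathcal A$, and an injective linear $\mathcal B:\hat{\mathbb E}\to\mathbb E$ with $\mathcal A\mathcal B=0$, $\mathcal B^*\mathcal B=\mathcal I$. The reduced barrier augmented Lagrangian (BAL) function is, with $x=\bar x+\mathcal B\hat x$, $$\eta_\rho(\hat x,s;\mu)=\min_{z\in\operatorname{int}(\mathbb K)}\Big\{\langle c,x\rangle+\mu\phi(z)+\langle s,z-x\rangle+\tfrac\rho2\|z-x\|^2\Big\},\quad (\hat x,s)\in\hat{\mathbb E}\times\mathbb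 E,$$ the minimum being attained at a unique point. Definitions. Let $\alpha>0$. (1) A convex $C^3$ function $f$ on an open convex domain $\mathbb X$ is $\alpha$-self-concordant on $\mathbb X$ if $f(x^{(k)})\to\infty$ along every sequence in $\mathbb X$ converging to a boundary point of $\mathbb X$ (a vacuous condition when $\mathbb X$ is the whole space) and $|D^3f(x)[h,h,h]|\le\frac{2}{\alpha^{1/2}}(D^2f(x)[h,h])^{3/2}$ for all $x\in\mathbb X$ and all directions $h$; it is nondegenerate if $D^2f(x)\succ0$ for all $x\in\mathbb X$. (2) A function $f\in C^3(\hat{\mathbb E}\times\mathbb E)$ is $\alpha$-self-concordant convex-concave on $\hat{\mathbb E}\times\mathbb E$ if $f(\cdot,s)$ is convex for every $s$, $f(\hat x,\cdot)$ is concave for every $\hat x$, and for all $w=(\hat x,s)$ and $h=(h_{\hat x},h_s)$, $|D^3f(w)[h,h,h]|\le\frac{2}{\alpha^{1/2}}(S_f(w)[h,h])^{3/2}$, where $S_f(w)[h,h]=D^2_{\hat x\hat x}f(w)[h_{\hat x},h_{\hat x}]-D^2_{ss}f(w)[h_s,h_s]$; it is nondegenerate if the quadratic form $S_f(w)$ is positive definite for all $w$. *)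

theory Defs
  imports "HOL-Analysis.Analysis"
begin

section \<open>Euclidean Jordan algebras\<close>

text \<open>The inner product of the ambient type is the associative inner product of the algebra.\<close>

locale euclidean_jordan_algebra =
  fixes jp :: "'e::euclidean_space \<Rightarrow> 'e \<Rightarrow> 'e"
    and e :: 'e
  assumes bilinear: "bilinear jp"
    and commute: "jp x y = jp y x"
    and jordan_identity: "jp x (jp (jp x x) y) = jp (jp x x) (jp x y)"
    and unit: "jp e x = x"
    and inner_assoc: "inner (jp x y) z = inner y (jp x z)"

definition jordan_power :: "('e \<Rightarrow> 'e \<Rightarrow> 'e) \<Rightarrow> 'e \<Rightarrow> 'e \<Rightarrow> nat \<Rightarrow> 'e" where
  "jordan_power jp e x n = (jp x ^^ n) e"

text \<open>
  The degree of \<open>x\<close> is the degree of its minimal polynomial, i.e. the least \<open>k > 0\<close> for which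
  the family \<open>e, x, \<dots>, x^k\<close> is linearly dependent (as a family: repetitions count). The rank
  is the largest degree; degrees are bounded by the dimension.
\<close>

definition jordan_degree :: "('e::euclidean_space \<Rightarrow> 'e \<Rightarrow> 'e) \<Rightarrow> 'e \<Rightarrow> 'e \<Rightarrow> nat" where
  "jordan_degree jp e x =
    (LEAST k. k > 0 \<and>
       (\<exists>a :: nat \<Rightarrow> real. (\<exists>i\<le>k. a i \<noteq> 0) \<and> (\<Sum>i\<le>k. a i *\<^sub>R jordan_power jp e x i) = 0))"

definition jordan_rank :: "('e::euclidean_space \<Rightarrow> 'e \<Rightarrow> 'e) \<Rightarrow> 'e \<Rightarrow> nat" where
  "jordan_rank jp e = Max (range (jordan_degree jp e))"

definition idempotent :: "('e \<Rightarrow> 'e \<Rightarrow> 'e) \<Rightarrow> 'e \<Rightarrow> bool" where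
  "idempotent jp p \<longleftrightarrow> jp p p = p"

definition primitive_idempotent :: "('e::euclidean_space \<Rightarrow> 'e \<Rightarrow> 'e) \<Rightarrow> 'e \<Rightarrow> bool" where
  "primitive_idempotent jp p \<longleftrightarrow>
     idempotent jp p \<and> p \<noteq> 0 \<and>
     \<not> (\<exists>q r. idempotent jp q \<and> idempotent jp r \<and> q \<noteq> 0 \<and> r \<noteq> 0 \<and> p = q + r)"

definition jordan_frame :: "('e::euclidean_space \<Rightarrow> 'e \<Rightarrow> 'e) \<Rightarrow> 'e \<Rightarrow> 'e set \<Rightarrow> bool" where
  "jordan_frame jp e F \<longleftrightarrow>
     finite F \<and> (\<forall>p\<in>F. primitive_idempotent jp p) \<and>
     (\<forall>p\<in>F. \<forall>q\<in>F. p \<noteq> q \<longrightarrow> jp p q = 0) \<and> \<Sum>F = e"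

text \<open>
  A spectral decomposition \<open>x = (\<Sum>p\<in>F. l p *\<^sub>R p)\<close>: here \<open>l p\<close> is the eigenvalue attached to the
  frame element \<open>p\<close>, so the family of values of \<open>l\<close> on \<open>F\<close> lists the eigenvalues of \<open>x\<close> with
  multiplicity.
\<close>

definition spectral_decomposition ::
  "('e::euclidean_space \<Rightarrow> 'e \<Rightarrow> 'e) \<Rightarrow> 'e \<Rightarrow> 'e \<Rightarrow> 'e set \<Rightarrow> ('e \<Rightarrow> real) \<Rightarrow> bool" where
  "spectral_decomposition jp e x F l \<longleftrightarrow> jordan_frame jp e F \<and> x = (\<Sum>p\<in>F. l p *\<^sub>R p)"

definition jordan_tr :: "('e::euclidean_space \<Rightarrow> 'e \<Rightarrow> 'e) \<Rightarrow> 'e \<Rightarrow> 'e \<Rightarrow> real" where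
  "jordan_tr jp e x = (THE t. \<exists>F l. spectral_decomposition jp e x F l \<and> t = (\<Sum>p\<in>F. l p))"

definition jordan_det :: "('e::euclidean_space \<Rightarrow> 'e \<Rightarrow> 'e) \<Rightarrow> 'e \<Rightarrow> 'e \<Rightarrow> real" where
  "jordan_det jp e x = (THE d. \<exists>F l. spectral_decomposition jp e x F l \<and> d = (\<Prod>p\<in>F. l p))"

definition cone_of_squares :: "('e \<Rightarrow> 'e \<Rightarrow> 'e) \<Rightarrow> 'e set" where
  "cone_of_squares jp = range (\<lambda>x. jp x x)"

definition log_det_barrier :: "('e::euclidean_space \<Rightarrow> 'e \<Rightarrow> 'e) \<Rightarrow> 'e \<Rightarrow> 'e \<Rightarrow> real" where
  "log_det_barrier jp e z = - ln (jordan_det jp e z)"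


section \<open>The reduced barrier augmented Lagrangian\<close>

definition reduced_BAL ::
  "('e::euclidean_space \<Rightarrow> 'e \<Rightarrow> 'e) \<Rightarrow> 'e \<Rightarrow> 'e \<Rightarrow> 'e \<Rightarrow> ('f \<Rightarrow> 'e) \<Rightarrow> real \<Rightarrow> real \<Rightarrow> 'f \<times> 'e \<Rightarrow> real"
  where
  "reduced_BAL jp e c xbar B \<rho> \<mu> = (\<lambda>(u, s).
     let x = xbar + B u in
     LEAST v. \<exists>z \<in> interior (cone_of_squares jp).
       v = inner c x + \<mu> * log_det_barrier jp e z + inner s (z - x) + \<rho> / 2 * (norm (z - x))\<^sup>2)"


section \<open>Self-concordance\<close>

text \<open>
  The iterated derivatives \<open>fderiv f\<close>, \<open>fderiv (fderiv f)\<close>, \<dots> take values in spaces of bounded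
  linear maps; they are meaningful where the function at hand is differentiable.
\<close>

definition fderiv ::
  "('a::real_normed_vector \<Rightarrow> 'b::real_normed_vector) \<Rightarrow> 'a \<Rightarrow> ('a \<Rightarrow>\<^sub>L 'b)" where
  "fderiv f x = Blinfun (frechet_derivative f (at x))"

definition C3_on :: "'a::real_normed_vector set \<Rightarrow> ('a \<Rightarrow> real) \<Rightarrow> bool" where
  "C3_on X f \<longleftrightarrow>
     (\<forall>x\<in>X. f differentiable (at x)) \<and>
     (\<forall>x\<in>X. fderiv f differentiable (at x)) \<and>
     (\<forall>x\<in>X. fderiv (fderiv f) differentiable (at x)) \<and>
     continuous_on X (fderiv (fderiv (fderiv f)))"

definition D2 :: "('a::real_normed_vector \<Rightarrow> real) \<Rightarrow> 'a \<Rightarrow> 'a \<Rightarrow> real" where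
  "D2 f x h = blinfun_apply (blinfun_apply (fderiv (fderiv f) x) h) h"

definition D3 :: "('a::real_normed_vector \<Rightarrow> real) \<Rightarrow> 'a \<Rightarrow> 'a \<Rightarrow> real" where
  "D3 f x h =
     blinfun_apply (blinfun_apply (blinfun_apply (fderiv (fderiv (fderiv f)) x) h) h) h"

definition self_concordant_on ::
  "real \<Rightarrow> 'a::real_normed_vector set \<Rightarrow> ('a \<Rightarrow> real) \<Rightarrow> bool" where
  "self_concordant_on \<alpha> X f \<longleftrightarrow>
     open X \<and> convex X \<and> convex_on X f \<and> C3_on X f \<and>
     (\<forall>u y. (\<forall>k. u k \<in> X) \<and> y \<in> frontier X \<and> u \<longlonglongrightarrow> y \<longrightarrow>
        filterlim (\<lambda>k::nat. f (u k)) at_top sequentially) \<and>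
     (\<forall>x\<in>X. \<forall>h. \<bar>D3 f x h\<bar> \<le> 2 / \<alpha> powr (1/2) * D2 f x h powr (3/2))"

definition nondegenerate_self_concordant_on ::
  "real \<Rightarrow> 'a::real_normed_vector set \<Rightarrow> ('a \<Rightarrow> real) \<Rightarrow> bool" where
  "nondegenerate_self_concordant_on \<alpha> X f \<longleftrightarrow>
     self_concordant_on \<alpha> X f \<and> (\<forall>x\<in>X. \<forall>h. h \<noteq> 0 \<longrightarrow> D2 f x h > 0)"

definition saddle_form ::
  "('a::real_normed_vector \<times> 'b::real_normed_vector \<Rightarrow> real) \<Rightarrow> 'a \<times> 'b \<Rightarrow> 'a \<times> 'b \<Rightarrow> real" where
  "saddle_form f w h =
     D2 (\<lambda>x. f (x, snd w)) (fst w) (fst h) - D2 (\<lambda>s. f (fst w, s)) (snd w) (snd h)"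

definition self_concordant_convex_concave ::
  "real \<Rightarrow> ('a::real_normed_vector \<times> 'b::real_normed_vector \<Rightarrow> real) \<Rightarrow> bool" where
  "self_concordant_convex_concave \<alpha> f \<longleftrightarrow>
     C3_on UNIV f \<and>
     (\<forall>s. convex_on UNIV (\<lambda>x. f (x, s))) \<and>
     (\<forall>x. concave_on UNIV (\<lambda>s. f (x, s))) \<and>
     (\<forall>w h. \<bar>D3 f w h\<bar> \<le> 2 / \<alpha> powr (1/2) * saddle_form f w h powr (3/2))"

definition nondegenerate_self_concordant_convex_concave ::
  "real \<Rightarrow> ('a::real_normed_vector \<times> 'b::real_normed_vector \<Rightarrow> real) \<Rightarrow> bool" where
  "nondegenerate_self_concordant_convex_concave \<alpha> f \<longleftrightarrow>
     self_concordant_convex_concave \<alpha> f \<and> (\<forall>w h. h \<noteq> 0 \<longrightarrow> saddle_form f w h > 0)"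

end

theory Submission
  imports Defs
begin

text \<open>
  Completing the square in the minimization over \<open>z\<close> gives, with \<open>x = xbar + B u\<close>,
  \<open>\<eta>(u, s) = \<langle>c, x\<rangle> - \<parallel>s\<parallel>\<^sup>2 / (2 \<rho>) + M (x - s / \<rho>)\<close>, where
  \<open>M y = min\<^sub>z (\<mu> \<phi> z + \<rho>/2 \<parallel>z - y\<parallel>\<^sup>2)\<close> is the Moreau envelope of the barrier
  (\<open>reduced_BAL_envelope\<close>). The theorem is thus a statement about the second and third derivatives of \<open>M\<close>.

  Put \<open>\<kappa> = \<mu> / \<rho>\<close> and let \<open>s\<close> now denote the square root of \<open>y\<^sup>2 + 4 \<kappa> e\<close>. The minimizer is
  \<open>z = (s + y) / 2\<close>; with \<open>w = (s - y) / 2\<close> one has \<open>z - w = y\<close> and \<open>z w = \<kappa> e\<close>, which is the optimality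
  condition. Minimality follows from the tangent inequality of the barrier
  (\<open>log_det_barrier_gradient_inequality\<close>): the inner products of the members of two Jordan frames
  form a doubly stochastic matrix, and the inequality is an average of scalar inequalities
  \<open>ln t \<le> t - 1\<close>. Smoothness follows from the equation \<open>s\<^sup>2 = y\<^sup>2 + 4 \<kappa> e\<close>, whose difference quotients can
  be solved because multiplication by \<open>s\<close> is uniformly coercive. In a direction \<open>h = s k\<close> one finds
  \<open>D\<^sup>2M[h,h] = \<rho> \<langle>w k, s k\<rangle>\<close> and \<open>D\<^sup>3M[h,h,h] = - 2 \<rho> \<langle>(z k)(w k), k\<rangle>\<close>.

  Two facts then give the self-concordance bound. First, \<open>sqrt \<kappa> \<bar>\<langle>(z k)(w k), k\<rangle>\<bar> \<le> \<langle>z k, w k\<rangle>\<^bsup>3/2\<^esup>\<close>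
  (\<open>scaled_cubic_bound\<close>). Decompose \<open>k\<close> into Peirce components with respect to a frame that
  diagonalizes \<open>z\<close>. A triple product of components vanishes unless their index pairs form a triangle,
  and on a triangle the symmetrized eigenvalues of \<open>z\<close> and \<open>w\<close> multiply to a product of three edge
  weights. Hence the trilinear expression is, up to a power of \<open>\<kappa>\<close>, \<open>\<langle>m m, m\<rangle>\<close> for a rescaled element
  \<open>m\<close>, and \<open>\<bar>\<langle>m m, m\<rangle>\<bar> \<le> \<parallel>m\<parallel>\<^sup>3\<close> because primitive idempotents are unit vectors for the trace form.
  Second, the saddle form dominates the quadratic form that occurs here (\<open>envelope_saddle\<close>): their
  difference is \<open>\<rho>\<close> times the square of a norm. Strict positivity comes from the injectivity of
  the multiplications by \<open>z\<close> and \<open>w\<close> and from the injectivity of \<open>B\<close>.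
\<close>

section \<open>The linearized Jordan identity\<close>

context euclidean_jordan_algebra
begin

notation jp (infixl "\<odot>" 70)

lemma jp_add_left: "(x + y) \<odot> z = x \<odot> z + y \<odot> z"
  using bilinear by (rule bilinear_ladd)

lemma jp_add_right: "x \<odot> (y + z) = x \<odot> y + x \<odot> z"
  using bilinear by (rule bilinear_radd)

lemma jp_diff_left: "(x - y) \<odot> z = x \<odot> z - y \<odot> z"
  using bilinear by (rule bilinear_lsub)

lemma jp_diff_right: "x \<odot> (y - z) = x \<odot> y - x \<odot> z"
  using bilinear by (rule bilinear_rsub)

lemma jp_scaleR_left [simp]: "(r *\<^sub>R x) \<odot> y = r *\<^sub>R (x \<odot> y)"
  using bilinear by (rule bilinear_lmul)

lemma jp_scaleR_right [simp]: "x \<odot> (r *\<^sub>R y) = r *\<^sub>R (x \<odot> y)"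
  using bilinear by (rule bilinear_rmul)

lemma jp_zero_left [simp]: "0 \<odot> x = 0"
  using bilinear by (rule bilinear_lzero)

lemma jp_zero_right [simp]: "x \<odot> 0 = 0"
  using bilinear by (rule bilinear_rzero)

lemma linear_jp: "linear ((\<odot>) x)"
  using bilinear by (simp add: bilinear_def)

lemma jp_sum_right: "x \<odot> (\<Sum>i\<in>I. f i) = (\<Sum>i\<in>I. x \<odot> f i)"
  by (rule linear_sum[OF linear_jp])

lemma jp_sum_left: "(\<Sum>i\<in>I. f i) \<odot> x = (\<Sum>i\<in>I. f i \<odot> x)"
  using jp_sum_right[of x f I] by (simp add: commute)

lemmas jp_linear = jp_add_left jp_add_right jp_diff_left jp_diff_right

lemma unit_right [simp]: "x \<odot> e = x"
  using unit commute by metis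

lemma unit_left [simp]: "e \<odot> x = x"
  by (rule unit)

lemma inner_jp_left: "inner (x \<odot> y) z = inner y (x \<odot> z)"
  by (rule inner_assoc)

lemma inner_jp_right: "inner x (y \<odot> z) = inner (x \<odot> y) z"
  by (metis inner_assoc commute)

text \<open>
  Full polarization of the cubic identity \<open>x (x\<^sup>2 u) = x\<^sup>2 (x u)\<close>: the inclusion-exclusion sum
  over \<open>x + y + z\<close>, the pairs and the single vectors isolates the part that is linear in each of
  the three arguments.
\<close>

lemma jordan_linearized:
  "x \<odot> ((y \<odot> z) \<odot> u) - (y \<odot> z) \<odot> (x \<odot> u) + y \<odot> ((z \<odot> x) \<odot> u) - (z \<odot> x) \<odot> (y \<odot> u)
   + z \<odot> ((x \<odot> y) \<odot> u) - (x \<odot> y) \<odot> (z \<odot> u) = 0"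
proof -
  define f where "f a = a \<odot> ((a \<odot> a) \<odot> u) - (a \<odot> a) \<odot> (a \<odot> u)" for a
  have f: "f a = 0" for a
    by (simp add: f_def jordan_identity)
  have "2 *\<^sub>R (x \<odot> ((y \<odot> z) \<odot> u) - (y \<odot> z) \<odot> (x \<odot> u) + y \<odot> ((z \<odot> x) \<odot> u)
        - (z \<odot> x) \<odot> (y \<odot> u) + z \<odot> ((x \<odot> y) \<odot> u) - (x \<odot> y) \<odot> (z \<odot> u))
      = f (x + y + z) - f (x + y) - f (y + z) - f (x + z) + f x + f y + f z"
    unfolding f_def jp_linear commute[of y x] commute[of z x] commute[of z y]
    by (simp add: scaleR_2)
  then show ?thesis by (simp add: f)
qed

text \<open>
  The same identity read as an operator acting on the first argument. It expresses multiplication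
  by a triple product through multiplications by products of two factors, and so carries all
  commutation facts below: powers of one element, idempotents and orthogonal idempotents are
  special cases.
\<close>

lemma jordan_operator_identity:
  "((y \<odot> z) \<odot> u) \<odot> v = (y \<odot> z) \<odot> (u \<odot> v) + (y \<odot> u) \<odot> (z \<odot> v) + (z \<odot> u) \<odot> (y \<odot> v)
     - y \<odot> (u \<odot> (z \<odot> v)) - z \<odot> (u \<odot> (y \<odot> v))"
proof -
  have "(u \<odot> v) \<odot> (y \<odot> z) = (y \<odot> z) \<odot> (u \<odot> v)" "(v \<odot> z) = z \<odot> v" "v \<odot> u = u \<odot> v"
    "v \<odot> y = y \<odot> v" "z \<odot> v \<odot> u = u \<odot> (z \<odot> v)" "y \<odot> v \<odot> u = u \<odot> (y \<odot> v)"
    "z \<odot> v \<odot> (y \<odot> u) = (y \<odot> u) \<odot> (z \<odot> v)" "y \<odot> v \<odot> (z \<odot> u) = (z \<odot> u) \<odot> (y \<odot> v)"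
    "v \<odot> (y \<odot> z \<odot> u) = (y \<odot> z \<odot> u) \<odot> v"
    by (simp_all only: commute)
  then show ?thesis
    using jordan_linearized[of v y z u] by (simp add: algebra_simps)
qed

section \<open>Idempotents\<close>

text \<open>
  Multiplication by an idempotent has its eigenvalues among \<open>0\<close>, \<open>1/2\<close> and \<open>1\<close>.
\<close>

lemma idempotent_cubic:
  assumes "idempotent jp c"
  shows "2 *\<^sub>R (c \<odot> (c \<odot> (c \<odot> v))) = 3 *\<^sub>R (c \<odot> (c \<odot> v)) - c \<odot> v"
proof -
  have c: "c \<odot> c = c" using assms by (simp add: idempotent_def)
  have three: "3 *\<^sub>R a = a + a + a" for a :: 'e
    using scaleR_left_distrib[of 2 1 a] by (simp add: scaleR_2)
  show ?thesis
    using jordan_operator_identity[of c c c v] unfolding c three scaleR_2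
    by (simp add: algebra_simps)
qed

text \<open>
  On the spectrum \<open>{0, 1/2, 1}\<close> the function \<open>t\<close> equals \<open>t\<^sup>2 + 4 (t - t\<^sup>2)\<^sup>2\<close>, so multiplication by an
  idempotent is a sum of squares of self-adjoint operators. This is the source of every positivity
  statement about the cone.
\<close>

lemma idempotent_inner_square:
  assumes "idempotent jp c"
  shows "inner (c \<odot> v) v = (norm (c \<odot> v))\<^sup>2 + 4 * (norm (c \<odot> v - c \<odot> (c \<odot> v)))\<^sup>2"
proof -
  define i1 i2 i3 i4 where "i1 = inner (c \<odot> v) v" and "i2 = inner (c \<odot> v) (c \<odot> v)"
    and "i3 = inner (c \<odot> (c \<odot> v)) (c \<odot> v)" and "i4 = inner (c \<odot> (c \<odot> v)) (c \<odot> (c \<odot> v))"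
  have "inner (2 *\<^sub>R (c \<odot> (c \<odot> (c \<odot> v)))) v = inner (3 *\<^sub>R (c \<odot> (c \<odot> v)) - c \<odot> v) v"
    and "inner (2 *\<^sub>R (c \<odot> (c \<odot> (c \<odot> v)))) (c \<odot> v) = inner (3 *\<^sub>R (c \<odot> (c \<odot> v)) - c \<odot> v) (c \<odot> v)"
    using idempotent_cubic[OF assms] by simp_all
  then have "2 * i3 = 3 * i2 - i1" "2 * i4 = 3 * i3 - i2"
    by (simp_all add: i1_def i2_def i3_def i4_def inner_jp_left jp_diff_right inner_diff_left inner_diff_right inner_commute)
  moreover have "(norm (c \<odot> v))\<^sup>2 = i2" by (simp add: i2_def power2_norm_eq_inner)
  moreover have "(norm (c \<odot> v - c \<odot> (c \<odot> v)))\<^sup>2 = i2 - 2 * i3 + i4"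
    by (simp add: i2_def i3_def i4_def power2_norm_eq_inner inner_diff inner_commute)
  ultimately show ?thesis unfolding i1_def[symmetric] by simp
qed

lemma idempotent_inner_nonneg: "idempotent jp c \<Longrightarrow> inner (c \<odot> v) v \<ge> 0"
  by (simp add: idempotent_inner_square)

lemma idempotent_inner_square_nonneg: "idempotent jp c \<Longrightarrow> inner c (v \<odot> v) \<ge> 0"
  using idempotent_inner_nonneg[of c v] by (metis inner_jp_right commute)

lemma idempotents_inner_nonneg: "idempotent jp c \<Longrightarrow> idempotent jp d \<Longrightarrow> inner c d \<ge> 0"
  using idempotent_inner_square_nonneg[of c d] by (simp add: idempotent_def)

text \<open>
  Positivity of the multiplication operator turns the numerical condition into the algebraic one.
\<close>

lemma idempotents_orthogonal_iff:
  assumes "idempotent jp c" "idempotent jp d"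
  shows "c \<odot> d = 0 \<longleftrightarrow> inner c d = 0"
proof
  assume "inner c d = 0"
  then have "inner (c \<odot> d) d = 0"
    using assms(2) by (metis idempotent_def inner_jp_right commute)
  with idempotent_inner_square[OF assms(1), of d]
  have "(norm (c \<odot> d))\<^sup>2 \<le> 0"
    by (smt (verit) zero_le_power2)
  then show "c \<odot> d = 0" by simp
next
  assume "c \<odot> d = 0"
  then show "inner c d = 0"
    using assms(2) by (metis idempotent_def inner_jp_right inner_zero_left commute)
qed

lemma idempotent_summands_orthogonal:
  assumes "idempotent jp q" "idempotent jp r" "idempotent jp (q + r)"
  shows "q \<odot> r = 0"
proof -
  have "q + r = (q + r) \<odot> (q + r)" using assms by (simp add: idempotent_def)
  also have "\<dots> = q + r + 2 *\<^sub>R (q \<odot> r)"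
    using assms by (simp add: idempotent_def jp_linear commute[of r q] scaleR_2)
  finally show ?thesis by simp
qed

text \<open>
  Needed to refine a system of idempotents: the two inner products \<open>\<langle>q, d\<rangle>\<close> and \<open>\<langle>r, d\<rangle>\<close> are
  nonnegative and sum to zero.
\<close>

lemma idempotent_summand_orthogonal:
  assumes "idempotent jp q" "idempotent jp r" "idempotent jp d" "(q + r) \<odot> d = 0"
    "idempotent jp (q + r)"
  shows "q \<odot> d = 0"
proof -
  have "inner q d + inner r d = 0"
    using idempotents_orthogonal_iff[OF assms(5,3)] assms(4) by (simp add: inner_add_left)
  then have "inner q d = 0"
    using idempotents_inner_nonneg[OF assms(1,3)] idempotents_inner_nonneg[OF assms(2,3)] by linarith
  then show ?thesis using idempotents_orthogonal_iff assms by blast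
qed

lemma orthogonal_idempotents_commute:
  assumes "idempotent jp p" "p \<odot> q = 0"
  shows "p \<odot> (q \<odot> v) = q \<odot> (p \<odot> v)"
  using jordan_linearized[of p p q v] assms by (simp add: idempotent_def commute[of q p])

lemma orthogonal_idempotents_half:
  assumes "idempotent jp p" "idempotent jp q" "p \<odot> q = 0"
  shows "2 *\<^sub>R (p \<odot> (p \<odot> (q \<odot> v))) = p \<odot> (q \<odot> v)"
proof -
  have "p \<odot> (q \<odot> v) = 2 *\<^sub>R (p \<odot> (q \<odot> (p \<odot> v)))"
    using jordan_operator_identity[of p p q v] assms
    by (simp add: idempotent_def scaleR_2 algebra_simps)
  moreover have "p \<odot> (p \<odot> (q \<odot> v)) = p \<odot> (q \<odot> (p \<odot> v))"
    using orthogonal_idempotents_commute[OF assms(1,3), of v] by simp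
  ultimately show ?thesis by metis
qed

lemma orthogonal_idempotents_triple:
  assumes "idempotent jp p" "idempotent jp q" "idempotent jp r"
    and "p \<odot> q = 0" "q \<odot> r = 0" "p \<odot> r = 0"
  shows "p \<odot> (q \<odot> (r \<odot> v)) = 0"
proof -
  have "p \<odot> (q \<odot> (r \<odot> v)) + r \<odot> (q \<odot> (p \<odot> v)) = 0"
    using jordan_operator_identity[of p r q v] assms
    by (simp add: commute[of r q] algebra_simps)
  moreover have "r \<odot> (q \<odot> (p \<odot> v)) = p \<odot> (q \<odot> (r \<odot> v))"
    using orthogonal_idempotents_commute assms commute by metis
  ultimately have "2 *\<^sub>R (p \<odot> (q \<odot> (r \<odot> v))) = 0" by (simp add: scaleR_2)
  then show ?thesis by simp
qed

text \<open>
  The linearized Jordan identity for \<open>c, x, y\<close>, applied to \<open>c\<close> itself. All Peirce multiplication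
  rules for one idempotent are contained in this single quadratic equation for the multiplication
  by \<open>c\<close> on \<open>x y\<close>.
\<close>

lemma peirce_product_rule:
  assumes "idempotent jp c" "c \<odot> x = a *\<^sub>R x" "c \<odot> y = b *\<^sub>R y"
  shows "c \<odot> (c \<odot> (x \<odot> y)) - c \<odot> (x \<odot> y) + (a - b)\<^sup>2 *\<^sub>R (x \<odot> y) = 0"
proof -
  have "c \<odot> c = c" "x \<odot> c = a *\<^sub>R x" "y \<odot> c = b *\<^sub>R y" "y \<odot> x = x \<odot> y" "x \<odot> y \<odot> c = c \<odot> (x \<odot> y)"
    using assms by (simp_all add: idempotent_def commute)
  then show ?thesis
    using jordan_linearized[of c x y c] assms(2,3)
    by (simp add: power2_eq_square algebra_simps flip: scaleR_2)
qed

lemma peirce_selection_rule: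
  assumes "idempotent jp c" "c \<odot> x = a *\<^sub>R x" "c \<odot> y = b *\<^sub>R y" "c \<odot> u = d *\<^sub>R u"
    and "inner (x \<odot> y) u \<noteq> 0"
  shows "d * (1 - d) = (a - b)\<^sup>2"
proof -
  have "inner (c \<odot> (x \<odot> y)) u = d * inner (x \<odot> y) u"
    "inner (c \<odot> (c \<odot> (x \<odot> y))) u = d * (d * inner (x \<odot> y) u)"
    using assms(4) by (simp_all add: inner_jp_left)
  moreover have "inner (c \<odot> (c \<odot> (x \<odot> y)) - c \<odot> (x \<odot> y) + (a - b)\<^sup>2 *\<^sub>R (x \<odot> y)) u = 0"
    using peirce_product_rule[OF assms(1-3)] by simp
  ultimately have "(d * d - d + (a - b)\<^sup>2) * inner (x \<odot> y) u = 0"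
    by (simp add: inner_add_left inner_diff_left algebra_simps)
  then have "d * d - d + (a - b)\<^sup>2 = 0" using assms(5) by simp
  then show ?thesis by (simp add: right_diff_distrib)
qed

end

section \<open>The spectral theorem\<close>

text \<open>
  A maximizer of the Rayleigh quotient on the unit sphere of \<open>V\<close> is an eigenvector: otherwise
  moving in the direction of the residual \<open>f v - r v\<close> would increase the quotient.
\<close>

lemma self_adjoint_eigenvector:
  fixes f :: "'a::euclidean_space \<Rightarrow> 'a"
  assumes f: "linear f" and sym: "\<And>u v. inner (f u) v = inner u (f v)"
    and V: "subspace V" and inv: "\<And>u. u \<in> V \<Longrightarrow> f u \<in> V" and ne: "w \<in> V" "w \<noteq> 0"
  obtains v r where "v \<in> V" "v \<noteq> 0" "f v = r *\<^sub>R v"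
proof -
  let ?S = "V \<inter> sphere 0 1"
  have cont: "continuous_on ?S (\<lambda>v. inner (f v) v)"
    by (intro continuous_intros linear_continuous_on f[unfolded linear_conv_bounded_linear])
  have "w /\<^sub>R norm w \<in> ?S"
    using ne V by (simp add: subspace_scale)
  moreover have "compact ?S"
    using V by (simp add: closed_Int_compact closed_subspace)
  ultimately obtain v where v: "v \<in> ?S" and max: "\<And>u. u \<in> ?S \<Longrightarrow> inner (f u) u \<le> inner (f v) v"
    using continuous_attains_sup[OF _ _ cont] by blast
  define r where "r = inner (f v) v"
  \<comment> \<open>\<open>Q\<close> is nonnegative on \<open>V\<close> and vanishes at \<open>v\<close>; along the residual \<open>d\<close> it is a quadratic polynomial
    whose slope at \<open>0\<close> is negative unless \<open>d = 0\<close>.\<close>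
  define Q where "Q u = r * (norm u)\<^sup>2 - inner (f u) u" for u
  have Q: "Q u \<ge> 0" if "u \<in> V" for u
  proof (cases "u = 0")
    case False
    then have "u /\<^sub>R norm u \<in> ?S"
      using that V by (simp add: subspace_scale)
    from max[OF this] have "inner (f u) u / (norm u)\<^sup>2 \<le> r"
      by (simp add: r_def linear_scale[OF f] power2_eq_square divide_inverse mult_ac)
    then show ?thesis
      using False by (simp add: Q_def field_simps)
  qed (simp add: Q_def linear_0[OF f])
  define d where "d = f v - r *\<^sub>R v"
  have d: "d \<in> V"
    using v inv V by (auto simp: d_def intro!: subspace_diff subspace_scale)
  have v1: "inner v v = 1" using v by (simp add: norm_eq_1)
  have expand: "Q (v + t *\<^sub>R d) = t\<^sup>2 * Q d - 2 * t * (norm d)\<^sup>2" for t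
  proof -
    have "inner (f d) v = inner (f v) d" by (metis sym inner_commute)
    moreover have "inner (f v) d = inner d d + r * inner v d"
      by (simp add: d_def inner_diff_left inner_diff_right algebra_simps inner_commute)
    ultimately show ?thesis
      unfolding Q_def power2_norm_eq_inner
      by (simp add: linear_add[OF f] linear_scale[OF f] inner_add_left inner_add_right v1
          inner_commute[of d v] power2_eq_square algebra_simps flip: r_def)
  qed
  have "norm d = 0"
  proof (rule ccontr)
    assume nd: "norm d \<noteq> 0"
    have nonneg: "0 \<le> t\<^sup>2 * Q d - 2 * t * (norm d)\<^sup>2" for t
      using Q[of "v + t *\<^sub>R d"] d v V by (simp add: expand subspace_add subspace_scale)
    have "Q d \<noteq> 0" using nonneg[of 1] nd by auto
    with Q[OF d] have "Q d > 0" by simp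
    with nonneg[of "(norm d)\<^sup>2 / Q d"] have "0 \<le> - ((norm d)\<^sup>2 * (norm d)\<^sup>2 / Q d)"
      by (simp add: power2_eq_square field_simps)
    moreover have "(norm d)\<^sup>2 * (norm d)\<^sup>2 / Q d > 0" using nd \<open>Q d > 0\<close> by simp
    ultimately show False by linarith
  qed
  then have "f v = r *\<^sub>R v" by (simp add: d_def)
  moreover have "v \<in> V" "v \<noteq> 0" using v by auto
  ultimately show thesis using that by blast
qed

context euclidean_jordan_algebra
begin

abbreviation jpow :: "'e \<Rightarrow> nat \<Rightarrow> 'e" where "jpow \<equiv> jordan_power jp e"

lemma jpow_0 [simp]: "jpow x 0 = e" and jpow_Suc: "jpow x (Suc n) = x \<odot> jpow x n"
  by (simp_all add: jordan_power_def)

text \<open>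
  The operator identity writes multiplication by \<open>x\<^bsup>n+2\<^esup>\<close> as a polynomial in the
  multiplications by \<open>x\<close>, \<open>x\<^sup>2\<close>, \<open>x\<^bsup>n\<^esup>\<close> and \<open>x\<^bsup>n+1\<^esup>\<close>; hence what commutes with the first two
  commutes with all.
\<close>

lemma commutes_with_powers:
  assumes X: "linear X" and 1: "\<And>v. X (x \<odot> v) = x \<odot> X v"
    and 2: "\<And>v. X ((x \<odot> x) \<odot> v) = (x \<odot> x) \<odot> X v"
  shows "X (jpow x n \<odot> v) = jpow x n \<odot> X v"
proof (induction n arbitrary: v rule: less_induct)
  case (less n)
  consider "n = 0" | "n = 1" | k where "n = Suc (Suc k)"
    by (metis One_nat_def not0_implies_Suc)
  then show ?case
  proof cases
    case 3
    define y where "y = jpow x k"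
    have y: "X (y \<odot> v) = y \<odot> X v" and yx: "X ((y \<odot> x) \<odot> v) = (y \<odot> x) \<odot> X v" for v
      using less[of k] less[of "Suc k"] 3 by (simp_all add: y_def jpow_Suc commute)
    have n: "jpow x n = (y \<odot> x) \<odot> x"
      by (simp add: 3 y_def jpow_Suc commute)
    show ?thesis
      unfolding n jordan_operator_identity[of y x x]
      by (simp add: linear_add[OF X] linear_diff[OF X] 1 2 y yx)
  qed (simp_all add: 1 jpow_Suc)
qed

lemma powers_commute: "jpow x m \<odot> (jpow x n \<odot> v) = jpow x n \<odot> (jpow x m \<odot> v)"
proof -
  have sq: "x \<odot> ((x \<odot> x) \<odot> v) = (x \<odot> x) \<odot> (x \<odot> v)" for v
    by (rule jordan_identity)
  have "x \<odot> (jpow x m \<odot> v) = jpow x m \<odot> (x \<odot> v)" for v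
    by (rule commutes_with_powers[OF linear_jp]) (simp_all add: sq)
  moreover have "(x \<odot> x) \<odot> (jpow x m \<odot> v) = jpow x m \<odot> ((x \<odot> x) \<odot> v)" for v
    by (rule commutes_with_powers[OF linear_jp]) (simp_all add: sq)
  ultimately show ?thesis
    by (intro commutes_with_powers linear_jp) simp_all
qed

text \<open>
  Power associativity.
\<close>

lemma jpow_add: "jpow x m \<odot> jpow x n = jpow x (m + n)"
proof (induction n)
  case (Suc n)
  have "jpow x m \<odot> (x \<odot> jpow x n) = x \<odot> (jpow x m \<odot> jpow x n)"
    using powers_commute[of x m "Suc 0"] by (simp add: jpow_Suc)
  with Suc show ?case by (simp add: jpow_Suc)
qed simp

text \<open>
  Multiplications by its elements commute with each other, so this is a commutative associative
  algebra; the spectral theorem only needs to be proved inside it.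
\<close>

definition generated_subalgebra :: "'e \<Rightarrow> 'e set" where
  "generated_subalgebra x = span (range (jpow x))"

lemma subspace_generated: "subspace (generated_subalgebra x)"
  by (simp add: generated_subalgebra_def)

lemma unit_in_generated: "e \<in> generated_subalgebra x"
  unfolding generated_subalgebra_def by (metis jpow_0 range_eqI span_base)

lemma generator_in_generated: "x \<in> generated_subalgebra x"
  unfolding generated_subalgebra_def by (metis jpow_0 jpow_Suc unit_right range_eqI span_base)

lemma generated_induct [consumes 1, case_names power zero add scale]:
  assumes "u \<in> generated_subalgebra x" "\<And>n. P (jpow x n)" "P 0"
    "\<And>u v. P u \<Longrightarrow> P v \<Longrightarrow> P (u + v)" "\<And>r u. P u \<Longrightarrow> P (r *\<^sub>R u)"
  shows "P u"
proof -
  have "subspace {u. P u}"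
    using assms(3-) by (auto simp: subspace_def)
  with assms(1,2) show ?thesis
    unfolding generated_subalgebra_def by (auto elim: span_induct)
qed

lemma generated_commute:
  assumes "u \<in> generated_subalgebra x" "w \<in> generated_subalgebra x"
  shows "u \<odot> (w \<odot> v) = w \<odot> (u \<odot> v)"
  using assms(1)
proof (induction arbitrary: v rule: generated_induct)
  case (power n)
  show ?case using assms(2)
    by (induction arbitrary: v rule: generated_induct) (simp_all add: powers_commute jp_linear)
qed (simp_all add: jp_linear)

lemma generated_closed:
  assumes "u \<in> generated_subalgebra x" "w \<in> generated_subalgebra x"
  shows "u \<odot> w \<in> generated_subalgebra x"
  using assms(1)
proof (induction rule: generated_induct)
  case (power n)
  show ?case using assms(2)
  proof (induction rule: generated_induct)
    case (power m)
    then show ?case by (auto simp: jpow_add generated_subalgebra_def intro: span_base)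
  qed (simp_all add: jp_linear subspace_generated subspace_0 subspace_add subspace_scale)
qed (simp_all add: jp_linear subspace_generated subspace_0 subspace_add subspace_scale)

text \<open>
  Every element is a polynomial in \<open>x\<close>, so it acts on an eigenvector of \<open>x\<close> by the value of that
  polynomial. In particular the square of an eigenvector lying in the subalgebra is a multiple of
  it, which is how idempotents arise.
\<close>

lemma generated_acts_by_scalar:
  assumes "x \<odot> v = r *\<^sub>R v" "v \<in> generated_subalgebra x" "u \<in> generated_subalgebra x"
  shows "\<exists>q. u \<odot> v = q *\<^sub>R v"
  using assms(3)
proof (induction rule: generated_induct)
  case (power n)
  have "jpow x n \<odot> v = r ^ n *\<^sub>R v"
  proof (induction n)
    case (Suc n)
    have "jpow x (Suc n) \<odot> v = x \<odot> (jpow x n \<odot> v)"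
      using generated_commute[OF assms(2) generator_in_generated, of "jpow x n"]
      by (simp add: jpow_Suc commute)
    with Suc show ?case by (simp add: assms(1))
  qed simp
  then show ?case ..
next
  case zero
  show ?case by (rule exI[of _ 0]) simp
next
  case (add u w)
  then show ?case by (metis jp_add_left scaleR_left_distrib)
next
  case (scale q u)
  then show ?case by (metis jp_scaleR_left scaleR_scaleR)
qed

definition orthogonal_idempotents :: "'e set \<Rightarrow> bool" where
  "orthogonal_idempotents S \<longleftrightarrow> finite S \<and> (\<forall>c\<in>S. idempotent jp c \<and> c \<noteq> 0)
     \<and> (\<forall>c\<in>S. \<forall>d\<in>S. c \<noteq> d \<longrightarrow> c \<odot> d = 0)"

text \<open>
  Orthogonal idempotents are orthogonal vectors, hence linearly independent. The bound makes it
  possible to choose systems of maximal size.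
\<close>

lemma orthogonal_idempotents_card:
  assumes "orthogonal_idempotents S"
  shows "card S \<le> DIM('e)"
proof -
  have "pairwise orthogonal S"
    using assms by (auto simp: pairwise_def orthogonal_def orthogonal_idempotents_def
        simp flip: idempotents_orthogonal_iff)
  moreover have "0 \<notin> S" using assms by (auto simp: orthogonal_idempotents_def)
  ultimately have "independent S" by (rule pairwise_orthogonal_independent)
  then show ?thesis by (rule independent_bound[THEN conjunct2])
qed

lemma largest_orthogonal_idempotents:
  assumes "P S" "\<And>S. P S \<Longrightarrow> orthogonal_idempotents S"
  obtains S where "P S" "\<And>S'. P S' \<Longrightarrow> card S' \<le> card S"
  using ex_has_greatest_nat[of P S card "Suc DIM('e)"] assms orthogonal_idempotents_card
  by (metis less_Suc_eq_le)

lemma orthogonal_idempotents_mult_sum: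
  assumes "orthogonal_idempotents S" "c \<in> S"
  shows "c \<odot> (\<Sum>d\<in>S. l d *\<^sub>R d) = l c *\<^sub>R c"
proof -
  have "c \<odot> (\<Sum>d\<in>S. l d *\<^sub>R d) = (\<Sum>d\<in>S. l d *\<^sub>R (c \<odot> d))"
    by (simp add: jp_sum_right)
  also have "\<dots> = (\<Sum>d\<in>S. if d = c then l c *\<^sub>R c else 0)"
    using assms by (intro sum.cong) (auto simp: orthogonal_idempotents_def idempotent_def)
  also have "\<dots> = l c *\<^sub>R c"
    using assms by (simp add: orthogonal_idempotents_def)
  finally show ?thesis .
qed

lemma idempotent_sum:
  assumes "orthogonal_idempotents S"
  shows "idempotent jp (\<Sum>S)"
proof -
  have "c \<odot> \<Sum>S = c" if "c \<in> S" for c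
    using orthogonal_idempotents_mult_sum[OF assms that, of "\<lambda>_. 1"] by simp
  then have "\<Sum>S \<odot> \<Sum>S = \<Sum>S" by (simp add: jp_sum_left)
  then show ?thesis by (simp add: idempotent_def)
qed

text \<open>
  Choose a largest orthogonal system of idempotents inside the subalgebra generated by \<open>x\<close> that
  consists of eigenvectors of \<open>x\<close>. If its complement \<open>f = e - \<Sum>S\<close> were nonzero, \<open>x\<close> would have an
  eigenvector in the ideal of \<open>f\<close>, and a multiple of it would be a further idempotent of the
  system.
\<close>

lemma idempotent_resolution:
  obtains S l where "orthogonal_idempotents S" "\<Sum>S = e" "x = (\<Sum>c\<in>S. l c *\<^sub>R c)"
proof -
  let ?W = "generated_subalgebra x"
  define P where "P S \<longleftrightarrow> orthogonal_idempotents S \<and> S \<subseteq> ?W \<and> (\<forall>c\<in>S. \<exists>r. x \<odot> c = r *\<^sub>R c)" for S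
  have "P {}" by (simp add: P_def orthogonal_idempotents_def)
  then obtain S where S: "P S" and max: "\<And>S'. P S' \<Longrightarrow> card S' \<le> card S"
    using largest_orthogonal_idempotents[of P "{}"] P_def by metis
  have oS: "orthogonal_idempotents S" and SW: "S \<subseteq> ?W" and eig: "\<And>c. c \<in> S \<Longrightarrow> \<exists>r. x \<odot> c = r *\<^sub>R c"
    using S by (auto simp: P_def)
  define f where "f = e - \<Sum>S"
  have cf: "c \<odot> f = 0" if "c \<in> S" for c
    using orthogonal_idempotents_mult_sum[OF oS that, of "\<lambda>_. 1"] by (simp add: f_def jp_linear)
  have ff: "f \<odot> f = f"
    using idempotent_sum[OF oS] by (simp add: f_def jp_linear idempotent_def)
  have fW: "f \<in> ?W"
    unfolding f_def using SW
    by (intro subspace_diff subspace_generated unit_in_generated subspace_sum) auto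
  have "f = 0"
  proof (rule ccontr)
    assume "f \<noteq> 0"
    \<comment> \<open>The ideal of \<open>f\<close>; it is annihilated by all members of \<open>S\<close>.\<close>
    define V where "V = {u \<in> ?W. f \<odot> u = u}"
    have V: "subspace V"
      using subspace_generated[of x] by (auto simp: subspace_def V_def jp_linear)
    have "f \<in> V" using ff fW by (simp add: V_def)
    have inv: "x \<odot> u \<in> V" if "u \<in> V" for u
      using that generated_closed[OF generator_in_generated, of u x]
        generated_commute[OF fW generator_in_generated, of u] by (simp add: V_def)
    obtain v r where v: "v \<in> V" "v \<noteq> 0" "x \<odot> v = r *\<^sub>R v"
      using self_adjoint_eigenvector[OF linear_jp inner_jp_left V inv \<open>f \<in> V\<close> \<open>f \<noteq> 0\<close>] by metis
    have vW: "v \<in> ?W" and fv: "f \<odot> v = v" using v(1) by (auto simp: V_def)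
    obtain q where q: "v \<odot> v = q *\<^sub>R v"
      using generated_acts_by_scalar[OF v(3) vW vW] by blast
    \<comment> \<open>The inner product of \<open>v \<odot> v\<close> with the unit is \<open>\<parallel>v\<parallel>\<^sup>2\<close>.\<close>
    have "q \<noteq> 0"
    proof
      assume "q = 0"
      then have "inner (v \<odot> v) e = 0" by (simp add: q)
      then show False using v(2) by (simp add: inner_jp_left)
    qed
    define c where "c = (1 / q) *\<^sub>R v"
    have cc: "c \<odot> c = c" and "c \<noteq> 0" and xc: "x \<odot> c = r *\<^sub>R c" and "c \<in> ?W"
      using \<open>q \<noteq> 0\<close> v vW by (simp_all add: c_def q subspace_generated subspace_scale)
    have cd: "c \<odot> d = 0" if "d \<in> S" for d
    proof -
      have "d \<odot> v = d \<odot> (v \<odot> f)" using fv by (simp add: commute)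
      also have "\<dots> = v \<odot> (d \<odot> f)"
        using that SW vW by (intro generated_commute) auto
      finally show ?thesis using cf[OF that] by (simp add: c_def commute)
    qed
    have "c \<notin> S" using cd cc \<open>c \<noteq> 0\<close> by metis
    moreover have "P (insert c S)"
      using oS SW eig cc xc cd \<open>c \<in> ?W\<close> \<open>c \<noteq> 0\<close>
      unfolding P_def orthogonal_idempotents_def idempotent_def
      by (simp; metis commute)
    ultimately show False
      using max[of "insert c S"] oS by (simp add: orthogonal_idempotents_def)
  qed
  then have sum: "\<Sum>S = e" by (simp add: f_def)
  obtain l where l: "\<And>c. c \<in> S \<Longrightarrow> x \<odot> c = l c *\<^sub>R c" using eig by metis
  have "x = (\<Sum>c\<in>S. x \<odot> c)" by (simp add: sum flip: jp_sum_right)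
  also have "\<dots> = (\<Sum>c\<in>S. l c *\<^sub>R c)" using l by simp
  finally show thesis using that oS sum by blast
qed

text \<open>
  Among the resolutions of the unit that diagonalize \<open>x\<close>, one of maximal size consists of
  primitive idempotents, because a decomposable member could be replaced by its two summands.
\<close>

lemma spectral_theorem:
  obtains F l where "spectral_decomposition jp e x F l"
proof -
  define P where "P S \<longleftrightarrow> orthogonal_idempotents S \<and> \<Sum>S = e \<and> (\<exists>l. x = (\<Sum>c\<in>S. l c *\<^sub>R c))" for S
  obtain S0 where "P S0" using idempotent_resolution[of x] unfolding P_def by metis
  then obtain F where F: "P F" and max: "\<And>S'. P S' \<Longrightarrow> card S' \<le> card F"
    using largest_orthogonal_idempotents[of P S0] P_def by metis
  obtain l where oF: "orthogonal_idempotents F" and sum: "\<Sum>F = e" and l: "x = (\<Sum>c\<in>F. l c *\<^sub>R c)"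
    using F by (auto simp: P_def)
  have fin: "finite F" using oF by (simp add: orthogonal_idempotents_def)
  have "primitive_idempotent jp c" if c: "c \<in> F" for c
  proof (rule ccontr)
    assume "\<not> primitive_idempotent jp c"
    then obtain q r where q: "idempotent jp q" "q \<noteq> 0" and r: "idempotent jp r" "r \<noteq> 0" and cqr: "c = q + r"
      using oF c unfolding primitive_idempotent_def orthogonal_idempotents_def by blast
    have ic: "idempotent jp (q + r)" using oF c cqr by (simp add: orthogonal_idempotents_def)
    have qr: "q \<odot> r = 0" using idempotent_summands_orthogonal q r ic by blast
    let ?G = "F - {c}"
    have qd: "q \<odot> d = 0" and rd: "r \<odot> d = 0" if "d \<in> ?G" for d
    proof -
      have d: "idempotent jp d" "(q + r) \<odot> d = 0"
        using that oF c by (auto simp: orthogonal_idempotents_def cqr)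
      show "q \<odot> d = 0" by (rule idempotent_summand_orthogonal[OF q(1) r(1) d ic])
      show "r \<odot> d = 0"
        using idempotent_summand_orthogonal[OF r(1) q(1) d(1)] d ic by (simp add: add.commute)
    qed
    have nq: "q \<notin> ?G" using qd[of q] q by (auto simp: idempotent_def)
    have nr: "r \<notin> ?G" using rd[of r] r by (auto simp: idempotent_def)
    have "q \<noteq> r" using qr q by (auto simp: idempotent_def)
    define l' where "l' d = (if d = q \<or> d = r then l c else l d)" for d
    let ?F' = "insert q (insert r ?G)"
    have "orthogonal_idempotents ?F'"
      using oF q r qr qd rd unfolding orthogonal_idempotents_def
      by (simp; metis commute)
    moreover have "\<Sum>?F' = e"
      using sum.remove[OF fin c, of "\<lambda>x. x"] nq nr \<open>q \<noteq> r\<close> fin by (simp add: sum cqr)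
    moreover have "x = (\<Sum>d\<in>?F'. l' d *\<^sub>R d)"
    proof -
      have "(\<Sum>d\<in>?G. l' d *\<^sub>R d) = (\<Sum>d\<in>?G. l d *\<^sub>R d)"
        using nq nr by (intro sum.cong) (auto simp: l'_def)
      then show ?thesis
        using sum.remove[OF fin c, of "\<lambda>d. l d *\<^sub>R d"] nq nr \<open>q \<noteq> r\<close> fin
        by (simp add: l l'_def scaleR_right_distrib cqr)
    qed
    ultimately have "P ?F'" unfolding P_def by blast
    then have "card ?F' \<le> card F" by (rule max)
    moreover have "card ?F' = Suc (card F)"
      using nq nr \<open>q \<noteq> r\<close> fin c by (simp add: card_Diff_singleton card_gt_0_iff) (metis Suc_pred card_gt_0_iff empty_iff)
    ultimately show False by simp
  qed
  then have "jordan_frame jp e F"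
    using oF sum by (simp add: jordan_frame_def orthogonal_idempotents_def)
  then show thesis using that l by (simp add: spectral_decomposition_def)
qed

end

section \<open>Peirce components of a complete system of idempotents\<close>

context euclidean_jordan_algebra
begin

definition spec :: "'e set \<Rightarrow> ('e \<Rightarrow> real) \<Rightarrow> 'e" where
  "spec F f = (\<Sum>p\<in>F. f p *\<^sub>R p)"

definition complete_idempotents :: "'e set \<Rightarrow> bool" where
  "complete_idempotents F \<longleftrightarrow> orthogonal_idempotents F \<and> \<Sum>F = e"

context
  fixes F assumes F: "complete_idempotents F"
begin

lemma complete_finite [simp]: "finite F"
  and complete_orthogonal: "orthogonal_idempotents F"
  and complete_sum: "\<Sum>F = e"
  and complete_idempotent: "p \<in> F \<Longrightarrow> idempotent jp p"
  and complete_mult: "p \<in> F \<Longrightarrow> q \<in> F \<Longrightarrow> p \<odot> q = (if p = q then p else 0)"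
  using F by (auto simp: complete_idempotents_def orthogonal_idempotents_def idempotent_def)

lemma complete_resolution: "(\<Sum>p\<in>F. p \<odot> v) = v"
  by (simp add: complete_sum flip: jp_sum_left)

lemma complete_commute: "p \<in> F \<Longrightarrow> q \<in> F \<Longrightarrow> p \<odot> (q \<odot> v) = q \<odot> (p \<odot> v)"
  by (cases "p = q") (auto intro: orthogonal_idempotents_commute simp: complete_idempotent complete_mult)

lemma spec_mult_right: "p \<in> F \<Longrightarrow> p \<odot> spec F f = f p *\<^sub>R p"
  unfolding spec_def by (rule orthogonal_idempotents_mult_sum[OF complete_orthogonal])

lemma spec_mult: "spec F f \<odot> spec F g = spec F (\<lambda>p. f p * g p)"
proof -
  have "spec F f \<odot> spec F g = (\<Sum>p\<in>F. f p *\<^sub>R (p \<odot> spec F g))"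
    by (simp add: spec_def[of F f] jp_sum_left)
  also have "\<dots> = spec F (\<lambda>p. f p * g p)"
    by (simp add: spec_mult_right) (simp add: spec_def)
  finally show ?thesis .
qed

lemma spec_apply: "spec F f \<odot> v = (\<Sum>p\<in>F. f p *\<^sub>R (p \<odot> v))"
  by (simp add: spec_def jp_sum_left)

text \<open>
  Elements with a common frame commute as multiplication operators.
\<close>

lemma spec_commute: "spec F f \<odot> (spec F g \<odot> v) = spec F g \<odot> (spec F f \<odot> v)"
proof -
  have expand: "spec F f \<odot> (spec F g \<odot> v) = (\<Sum>q\<in>F. \<Sum>p\<in>F. (f p * g q) *\<^sub>R (p \<odot> (q \<odot> v)))" for f g
    by (simp add: spec_apply jp_sum_right scaleR_sum_right mult.commute)
  have "spec F f \<odot> (spec F g \<odot> v) = (\<Sum>p\<in>F. \<Sum>q\<in>F. (f p * g q) *\<^sub>R (p \<odot> (q \<odot> v)))"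
    unfolding expand by (rule sum.swap)
  also have "\<dots> = spec F g \<odot> (spec F f \<odot> v)"
    unfolding expand by (intro sum.cong refl) (simp add: complete_commute mult.commute)
  finally show ?thesis .
qed

lemma spec_add: "spec F f + spec F g = spec F (\<lambda>p. f p + g p)"
  and spec_diff: "spec F f - spec F g = spec F (\<lambda>p. f p - g p)"
  and spec_scale: "r *\<^sub>R spec F f = spec F (\<lambda>p. r * f p)"
  and spec_const: "spec F (\<lambda>p. r) = r *\<^sub>R e"
  by (simp_all add: spec_def scaleR_left_distrib scaleR_left_diff_distrib sum.distrib sum_subtractf
      scaleR_sum_right complete_sum) (simp add: complete_sum flip: scaleR_sum_right)

lemma spec_coercive:
  assumes "\<And>p. p \<in> F \<Longrightarrow> r \<le> f p"
  shows "r * (norm v)\<^sup>2 \<le> inner (spec F f \<odot> v) v"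
proof -
  have "r * (norm v)\<^sup>2 = (\<Sum>p\<in>F. r * inner (p \<odot> v) v)"
    using complete_resolution[of v]
    by (simp add: power2_norm_eq_inner flip: sum_distrib_left inner_sum_left)
  also have "\<dots> \<le> (\<Sum>p\<in>F. f p * inner (p \<odot> v) v)"
    by (intro sum_mono mult_right_mono assms idempotent_inner_nonneg complete_idempotent)
  also have "\<dots> = inner (spec F f \<odot> v) v"
    by (simp add: spec_apply inner_sum_left)
  finally show ?thesis .
qed

text \<open>
  For \<open>p \<noteq> q\<close> the value on the ordered pair \<open>(p, q)\<close> is half of the usual projection onto the Peirce
  space of \<open>{p, q}\<close>; summing over ordered pairs then recovers the vector, and no order on the
  frame has to be chosen.
\<close>

definition peirce :: "'e \<times> 'e \<Rightarrow> 'e \<Rightarrow> 'e" where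
  "peirce a v = (if fst a = snd a then 2 *\<^sub>R (fst a \<odot> (snd a \<odot> v)) - fst a \<odot> v
     else 2 *\<^sub>R (fst a \<odot> (snd a \<odot> v)))"

text \<open>
  The eigenvalue of \<open>c\<close> on the Peirce space of the edge \<open>a\<close>: half the number of endpoints of \<open>a\<close>
  equal to \<open>c\<close>.
\<close>

definition half_degree :: "'e \<times> 'e \<Rightarrow> 'e \<Rightarrow> real" where
  "half_degree a c = (of_bool (c = fst a) + of_bool (c = snd a)) / 2"

lemma sum_peirce: "(\<Sum>a\<in>F \<times> F. peirce a v) = v"
proof -
  have "(\<Sum>a\<in>F \<times> F. peirce a v)
      = (\<Sum>p\<in>F. \<Sum>q\<in>F. 2 *\<^sub>R (p \<odot> (q \<odot> v)) - (if q = p then p \<odot> v else 0))"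
    by (simp add: sum.cartesian_product peirce_def split_def) (intro sum.cong; auto)
  also have "\<dots> = 2 *\<^sub>R v - v"
    by (simp add: sum_subtractf complete_resolution flip: scaleR_sum_right jp_sum_right)
  finally show ?thesis by (simp add: scaleR_2)
qed

lemma peirce_eigen:
  assumes "a \<in> F \<times> F" "c \<in> F"
  shows "c \<odot> peirce a v = half_degree a c *\<^sub>R peirce a v"
proof -
  obtain p q where a: "a = (p, q)" and pq: "p \<in> F" "q \<in> F" using assms(1) by auto
  have cubic: "2 *\<^sub>R (p \<odot> (p \<odot> (p \<odot> v))) = 3 *\<^sub>R (p \<odot> (p \<odot> v)) - p \<odot> v"
    using idempotent_cubic complete_idempotent pq by blast
  have half: "2 *\<^sub>R (r \<odot> (r \<odot> (s \<odot> v))) = r \<odot> (s \<odot> v)" if "r \<in> F" "s \<in> F" "r \<noteq> s" for r s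
    using orthogonal_idempotents_half complete_idempotent that complete_mult by metis
  consider "p = q" "c = p" | "p = q" "c \<noteq> p" | "p \<noteq> q" "c = p" | "p \<noteq> q" "c = q"
    | "p \<noteq> q" "c \<noteq> p" "c \<noteq> q" by blast
  then show ?thesis
  proof cases
    case 1
    have "3 *\<^sub>R u = u + 2 *\<^sub>R u" for u :: 'e
      using scaleR_left_distrib[of 1 2 u] by simp
    with 1 show ?thesis
      using cubic by (simp add: a peirce_def half_degree_def jp_linear)
  next
    case 2
    then show ?thesis
      using half[of p c] pq assms(2) complete_commute[of c p]
      by (simp add: a peirce_def half_degree_def jp_linear)
  next
    case 3
    then show ?thesis
      using half[of p q] pq by (simp add: a peirce_def half_degree_def)
  next
    case 4
    then show ?thesis
      using half[of q p] pq complete_commute[of p q] by (simp add: a peirce_def half_degree_def)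
  next
    case 5
    then have "c \<odot> (p \<odot> (q \<odot> v)) = 0"
      using pq assms(2) complete_mult by (intro orthogonal_idempotents_triple complete_idempotent) auto
    with 5 show ?thesis by (simp add: a peirce_def half_degree_def)
  qed
qed

lemma spec_peirce:
  assumes "a \<in> F \<times> F"
  shows "spec F f \<odot> peirce a v = ((f (fst a) + f (snd a)) / 2) *\<^sub>R peirce a v"
proof -
  have "spec F f \<odot> peirce a v = (\<Sum>c\<in>F. f c *\<^sub>R (half_degree a c *\<^sub>R peirce a v))"
    by (simp add: spec_apply peirce_eigen[OF assms])
  also have "\<dots> = (\<Sum>c\<in>F. f c * half_degree a c) *\<^sub>R peirce a v"
    by (simp add: scaleR_sum_left)
  also have "(\<Sum>c\<in>F. f c * half_degree a c)
      = (\<Sum>c\<in>F. (if c = fst a then f (fst a) / 2 else 0) + (if c = snd a then f (snd a) / 2 else 0))"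
    by (intro sum.cong) (auto simp: half_degree_def)
  also have "\<dots> = (f (fst a) + f (snd a)) / 2"
    using assms by (auto simp: sum.distrib add_divide_distrib)
  finally show ?thesis .
qed

lemma peirce_orthogonal:
  assumes "a \<in> F \<times> F" "b \<in> F \<times> F" "inner (peirce a u) (peirce b v) \<noteq> 0"
  shows "a = b \<or> a = prod.swap b"
proof -
  have h: "half_degree a c = half_degree b c" if "c \<in> F" for c
  proof -
    have "inner (c \<odot> peirce a u) (peirce b v) = inner (peirce a u) (c \<odot> peirce b v)"
      by (rule inner_jp_left)
    then show ?thesis using assms that by (simp add: peirce_eigen)
  qed
  obtain p q r s where "a = (p, q)" "b = (r, s)" "p \<in> F" "q \<in> F" "r \<in> F" "s \<in> F"
    using assms(1,2) by auto
  then show ?thesis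
    using h[of p] h[of q] h[of r] h[of s]
    by (simp add: half_degree_def of_bool_def split: if_splits)
qed

end

end

section \<open>Triple products of Peirce components\<close>

text \<open>
  The combinatorial core of the Peirce rules. Three edges \<open>ij\<close>, \<open>kl\<close>, \<open>mn\<close> (loops allowed) that satisfy
  the selection rule at every vertex close up to a triangle.
\<close>

lemma triangle_of_half_degrees:
  fixes i j k l m n :: 'a
  defines "a \<equiv> \<lambda>v. (of_bool (v = i) + of_bool (v = j)) / (2::real)"
    and "b \<equiv> \<lambda>v. (of_bool (v = k) + of_bool (v = l)) / (2::real)"
    and "c \<equiv> \<lambda>v. (of_bool (v = m) + of_bool (v = n)) / (2::real)"
  assumes rule: "\<And>v. v \<in> {i, j, k, l, m, n} \<Longrightarrow> a v * (1 - a v) = (b v - c v)\<^sup>2"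
    "\<And>v. v \<in> {i, j, k, l, m, n} \<Longrightarrow> b v * (1 - b v) = (c v - a v)\<^sup>2"
    "\<And>v. v \<in> {i, j, k, l, m, n} \<Longrightarrow> c v * (1 - c v) = (a v - b v)\<^sup>2"
  shows "\<exists>p q r. (i = p \<and> j = q \<or> i = q \<and> j = p) \<and> (k = q \<and> l = r \<or> k = r \<and> l = q)
    \<and> (m = r \<and> n = p \<or> m = p \<and> n = r)"
proof -
  have truth_table: "(vi \<noteq> vj) = ((vk \<noteq> vl) \<noteq> (vm \<noteq> vn)) \<and> (vi = vj \<and> vk = vl \<longrightarrow> vi = vk \<and> vk = vm)"
    if "x = (of_bool vi + of_bool vj) / (2::real)" "y = (of_bool vk + of_bool vl) / (2::real)"
       "z = (of_bool vm + of_bool vn) / (2::real)"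
       "x * (1 - x) = (y - z)\<^sup>2" "y * (1 - y) = (z - x)\<^sup>2" "z * (1 - z) = (x - y)\<^sup>2"
    for vi vj vk vl vm vn x y z
    using that
    by (cases vi; cases vj; cases vk; cases vl; cases vm; cases vn)
       (simp_all add: power2_eq_square)
  have R: "((v = i) \<noteq> (v = j)) = (((v = k) \<noteq> (v = l)) \<noteq> ((v = m) \<noteq> (v = n)))
      \<and> ((v = i) = (v = j) \<and> (v = k) = (v = l) \<longrightarrow> (v = i) = (v = k) \<and> (v = k) = (v = m))"
    if "v \<in> {i, j, k, l, m, n}" for v
    by (rule truth_table[OF _ _ _ rule(1)[OF that] rule(2)[OF that] rule(3)[OF that]]) (simp_all add: a_def b_def c_def)
  have "(i = m \<and> (j = k \<and> l = n \<or> j = l \<and> k = n)) \<or> (i = n \<and> (j = k \<and> l = m \<or> j = l \<and> k = m))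
    \<or> (j = m \<and> (i = k \<and> l = n \<or> i = l \<and> k = n)) \<or> (j = n \<and> (i = k \<and> l = m \<or> i = l \<and> k = m))"
    using R[of i] R[of j] R[of k] R[of l] R[of m] R[of n]
    by (smt (verit) insert_iff)
  then show ?thesis by blast
qed

text \<open>
  The identity behind self-concordance. With vertex weights \<open>x\<^sup>2\<close>, the two factors \<open>s\<close> and \<open>t\<close> are the
  eigenvalues on an edge of an element and of its inverse; after symmetrization over the three edges
  of a triangle, their product equals the product of the edge weights \<open>g\<close>, where \<open>g\<^sup>2 = s t\<close> on each
  edge.
\<close>

lemma triangle_scaling_identity:
  fixes x y z :: real
  assumes "x > 0" "y > 0" "z > 0"
  defines "s \<equiv> \<lambda>u v. (u\<^sup>2 + v\<^sup>2) / (2::real)" and "t \<equiv> \<lambda>u v. (1 / u\<^sup>2 + 1 / v\<^sup>2) / (2::real)"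
    and "g \<equiv> \<lambda>u v. (u\<^sup>2 + v\<^sup>2) / (2 * u * v :: real)"
  shows "s x y * t y z + s y z * t x y + s x y * t z x + s z x * t x y + s y z * t z x + s z x * t y z
    = 6 * (g x y * g y z * g z x)"
proof -
  define X X' Y Y' Z Z' where "X = x\<^sup>2" "X' = 1 / x\<^sup>2" "Y = y\<^sup>2" "Y' = 1 / y\<^sup>2" "Z = z\<^sup>2" "Z' = 1 / z\<^sup>2"
  note defs = this
  have inv: "X * X' = 1" "Y * Y' = 1" "Z * Z' = 1"
    using assms(1-3) by (simp_all add: defs)
  have st: "s u v * t p q = (u\<^sup>2 + v\<^sup>2) * (1 / p\<^sup>2 + 1 / q\<^sup>2) / 4" for u v p q
    by (simp add: s_def t_def)
  have lin: "8 * h = c \<Longrightarrow> a1 + a2 + a3 + a4 + a5 + a6 = 3 * c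
    \<Longrightarrow> a1 / 4 + a2 / 4 + a3 / 4 + a4 / 4 + a5 / 4 + a6 / 4 = 6 * h"
    for a1 a2 a3 a4 a5 a6 c h :: real
    by simp
  have "8 * (g x y * g y z * g z x) = (X + Y) * (Y + Z) * (Z + X) * X' * Y' * Z'"
    using assms(1-3) by (simp add: g_def defs power2_eq_square)
  moreover have "(X + Y) * (Y' + Z') + (Y + Z) * (X' + Y') + (X + Y) * (Z' + X') + (Z + X) * (X' + Y')
      + (Y + Z) * (Z' + X') + (Z + X) * (Y' + Z') = 3 * ((X + Y) * (Y + Z) * (Z + X) * X' * Y' * Z')"
    using inv by algebra
  ultimately show ?thesis
    unfolding st defs by (rule lin)
qed

context euclidean_jordan_algebra
begin

lemma trilinear_rotate: "inner (x \<odot> y) u = inner (y \<odot> u) x"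
  by (metis inner_jp_left inner_commute commute)

context
  fixes F assumes F: "complete_idempotents F"
begin

lemma peirce_triple_triangle:
  assumes mem: "a \<in> F \<times> F" "b \<in> F \<times> F" "c \<in> F \<times> F"
    and ne: "inner (peirce a u \<odot> peirce b u) (peirce c u) \<noteq> 0"
  shows "\<exists>p q r. (fst a = p \<and> snd a = q \<or> fst a = q \<and> snd a = p)
    \<and> (fst b = q \<and> snd b = r \<or> fst b = r \<and> snd b = q) \<and> (fst c = r \<and> snd c = p \<or> fst c = p \<and> snd c = r)"
proof (rule triangle_of_half_degrees)
  fix v assume "v \<in> {fst a, snd a, fst b, snd b, fst c, snd c}"
  then have v: "v \<in> F" using mem by auto
  note eig = peirce_eigen[OF F mem(1) v, of u] peirce_eigen[OF F mem(2) v, of u]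
    peirce_eigen[OF F mem(3) v, of u]
  have ne2: "inner (peirce b u \<odot> peirce c u) (peirce a u) \<noteq> 0"
    using ne by (metis trilinear_rotate)
  then have ne3: "inner (peirce c u \<odot> peirce a u) (peirce b u) \<noteq> 0"
    by (metis trilinear_rotate)
  show "(of_bool (v = fst a) + of_bool (v = snd a)) / 2 * (1 - (of_bool (v = fst a) + of_bool (v = snd a)) / 2) =
         ((of_bool (v = fst b) + of_bool (v = snd b)) / 2 - (of_bool (v = fst c) + of_bool (v = snd c)) / 2 :: real)\<^sup>2"
    by (rule peirce_selection_rule[OF complete_idempotent[OF F v] eig(2,3,1) ne2, unfolded half_degree_def[OF F]])
  show "(of_bool (v = fst b) + of_bool (v = snd b)) / 2 * (1 - (of_bool (v = fst b) + of_bool (v = snd b)) / 2) =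
         ((of_bool (v = fst c) + of_bool (v = snd c)) / 2 - (of_bool (v = fst a) + of_bool (v = snd a)) / 2 :: real)\<^sup>2"
    by (rule peirce_selection_rule[OF complete_idempotent[OF F v] eig(3,1,2) ne3, unfolded half_degree_def[OF F]])
  show "(of_bool (v = fst c) + of_bool (v = snd c)) / 2 * (1 - (of_bool (v = fst c) + of_bool (v = snd c)) / 2) =
         ((of_bool (v = fst a) + of_bool (v = snd a)) / 2 - (of_bool (v = fst b) + of_bool (v = snd b)) / 2 :: real)\<^sup>2"
    by (rule peirce_selection_rule[OF complete_idempotent[OF F v] eig(1,2,3) ne, unfolded half_degree_def[OF F]])
qed

end

lemma sum3_symmetrize:
  fixes f T :: "'i \<Rightarrow> 'i \<Rightarrow> 'i \<Rightarrow> real"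
  assumes 1: "\<And>a b c. T a b c = T b a c" and 2: "\<And>a b c. T a b c = T b c a"
  shows "6 * (\<Sum>a\<in>G. \<Sum>b\<in>G. \<Sum>c\<in>G. f a b c * T a b c)
    = (\<Sum>a\<in>G. \<Sum>b\<in>G. \<Sum>c\<in>G. (f a b c + f b a c + f a c b + f c a b + f b c a + f c b a) * T a b c)"
proof -
  let ?S = "\<lambda>h. \<Sum>a\<in>G. \<Sum>b\<in>G. \<Sum>c\<in>G. h a b c * T a b c"
  have s1: "?S (\<lambda>a b c. h b a c) = ?S h" for h
    by (subst sum.swap) (simp add: 1)
  have T': "T a b c = T a c b" for a b c by (metis 1 2)
  have s2: "?S (\<lambda>a b c. h a c b) = ?S h" for h
  proof (rule sum.cong[OF refl])
    show "(\<Sum>b\<in>G. \<Sum>c\<in>G. h a c b * T a b c) = (\<Sum>b\<in>G. \<Sum>c\<in>G. h a b c * T a b c)" for a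
      by (subst sum.swap) (intro sum.cong refl, subst T', rule refl)
  qed
  have "?S (\<lambda>a b c. f c a b) = ?S f" using s2[of "\<lambda>a b c. f b a c"] s1[of f] by simp
  moreover have "?S (\<lambda>a b c. f b c a) = ?S f" using s1[of "\<lambda>a b c. f a c b"] s2[of f] by simp
  moreover have "?S (\<lambda>a b c. f c b a) = ?S f"
    using s1[of "\<lambda>a b c. f c a b"] calculation by simp
  ultimately show ?thesis
    using s1[of f] s2[of f] by (simp add: distrib_right sum.distrib)
qed

text \<open>
  The element \<open>m\<close> multiplies the Peirce component of \<open>k\<close> on each edge by the weight \<open>g\<close>. Only
  triangles contribute to the trilinear form, and on a triangle the weights agree by
  \<open>triangle_scaling_identity\<close>; in the quadratic form only equal edges contribute, where
  \<open>g\<^sup>2 = s t\<close>.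
\<close>

lemma peirce_rescaling:
  assumes F: "complete_idempotents F" and r: "\<And>p. p \<in> F \<Longrightarrow> r p > 0"
  defines "z \<equiv> spec F (\<lambda>p. (r p)\<^sup>2)" and "w \<equiv> spec F (\<lambda>p. 1 / (r p)\<^sup>2)"
  obtains m where "inner (m \<odot> m) m = inner ((z \<odot> k) \<odot> (w \<odot> k)) k"
    and "(norm m)\<^sup>2 = inner (z \<odot> k) (w \<odot> k)"
proof -
  let ?G = "F \<times> F"
  define s where "s a = ((r (fst a))\<^sup>2 + (r (snd a))\<^sup>2) / 2" for a :: "'e \<times> 'e"
  define t where "t a = (1 / (r (fst a))\<^sup>2 + 1 / (r (snd a))\<^sup>2) / 2" for a :: "'e \<times> 'e"
  define g where "g a = ((r (fst a))\<^sup>2 + (r (snd a))\<^sup>2) / (2 * r (fst a) * r (snd a))" for a :: "'e \<times> 'e"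
  \<comment> \<open>The arguments are reversed because expansion of the inner product puts the sum over its last
    factor outermost.\<close>
  define T where "T a b c = inner (peirce c k \<odot> peirce b k) (peirce a k)" for a b c
  define m where "m = (\<Sum>a\<in>?G. g a *\<^sub>R peirce a k)"
  have zk: "z \<odot> k = (\<Sum>a\<in>?G. s a *\<^sub>R peirce a k)"
    and wk: "w \<odot> k = (\<Sum>a\<in>?G. t a *\<^sub>R peirce a k)"
    by (subst sum_peirce[OF F, of k, symmetric],
        simp add: z_def w_def jp_sum_right spec_peirce[OF F] s_def t_def)+
  have k: "k = (\<Sum>a\<in>?G. 1 *\<^sub>R peirce a k)" by (simp add: sum_peirce[OF F])
  have cubic: "inner ((\<Sum>a\<in>?G. f a *\<^sub>R peirce a k) \<odot> (\<Sum>a\<in>?G. f' a *\<^sub>R peirce a k)) (\<Sum>a\<in>?G. f'' a *\<^sub>R peirce a k)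
      = (\<Sum>a\<in>?G. \<Sum>b\<in>?G. \<Sum>c\<in>?G. (f c * f' b * f'' a) * T a b c)" for f f' f''
    by (simp add: jp_sum_left jp_sum_right inner_sum_left inner_sum_right T_def sum_distrib_left mult_ac)
  have T1: "T a b c = T b a c" and T2: "T a b c = T b c a" for a b c
    using trilinear_rotate[of "peirce c k" "peirce b k" "peirce a k"]
      trilinear_rotate[of "peirce b k" "peirce a k" "peirce c k"]
    by (simp_all add: T_def commute[of "peirce c k" "peirce a k"])
  have "6 * inner ((z \<odot> k) \<odot> (w \<odot> k)) k = 6 * (\<Sum>a\<in>?G. \<Sum>b\<in>?G. \<Sum>c\<in>?G. (s c * t b) * T a b c)"
    using cubic[of s t "\<lambda>_. 1"] unfolding zk[symmetric] wk[symmetric] k[symmetric] by simp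
  also have "\<dots> = (\<Sum>a\<in>?G. \<Sum>b\<in>?G. \<Sum>c\<in>?G. (s c * t b + s c * t a + s b * t c + s b * t a + s a * t c + s a * t b) * T a b c)"
    by (rule sum3_symmetrize[OF T1 T2])
  also have "\<dots> = (\<Sum>a\<in>?G. \<Sum>b\<in>?G. \<Sum>c\<in>?G. 6 * ((g c * g b * g a) * T a b c))"
  proof (intro sum.cong refl)
    fix a b c assume mem: "a \<in> ?G" "b \<in> ?G" "c \<in> ?G"
    have "s c * t b + s c * t a + s b * t c + s b * t a + s a * t c + s a * t b = 6 * (g c * g b * g a)"
      if "T a b c \<noteq> 0"
    proof -
      obtain x y v where "fst c = x \<and> snd c = y \<or> fst c = y \<and> snd c = x"
        "fst b = y \<and> snd b = v \<or> fst b = v \<and> snd b = y" "fst a = v \<and> snd a = x \<or> fst a = x \<and> snd a = v"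
        using peirce_triple_triangle[OF F mem(3,2,1)] \<open>T a b c \<noteq> 0\<close> unfolding T_def by blast
      moreover from this have "r x > 0" "r y > 0" "r v > 0"
        using mem r by auto
      note triangle_scaling_identity[OF this]
      ultimately show ?thesis
        unfolding s_def t_def g_def by (elim disjE conjE) (simp_all add: ac_simps)
    qed
    then show "(s c * t b + s c * t a + s b * t c + s b * t a + s a * t c + s a * t b) * T a b c
        = 6 * ((g c * g b * g a) * T a b c)"
      by (cases "T a b c = 0") auto
  qed
  also have "\<dots> = 6 * inner (m \<odot> m) m"
    by (simp only: m_def cubic flip: sum_distrib_left)
  finally have "inner (m \<odot> m) m = inner ((z \<odot> k) \<odot> (w \<odot> k)) k" by simp
  moreover have "(norm m)\<^sup>2 = inner (z \<odot> k) (w \<odot> k)"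
  proof -
    have quad: "inner (\<Sum>a\<in>?G. f a *\<^sub>R peirce a k) (\<Sum>a\<in>?G. f' a *\<^sub>R peirce a k)
      = (\<Sum>a\<in>?G. \<Sum>b\<in>?G. (f b * f' a) * inner (peirce b k) (peirce a k))" for f f'
      by (simp add: inner_sum_left inner_sum_right sum_distrib_left mult_ac)
    have "g a * g b * inner (peirce a k) (peirce b k) = s a * t b * inner (peirce a k) (peirce b k)"
      if mem: "a \<in> ?G" "b \<in> ?G" for a b
    proof (cases "inner (peirce a k) (peirce b k) = 0")
      case False
      then have "a = b \<or> a = prod.swap b" using peirce_orthogonal[OF F mem] by blast
      moreover have "r (fst a) > 0" "r (snd a) > 0" using mem r by auto
      ultimately have "g a * g b = s a * t b"
        by (elim disjE) (simp_all add: g_def s_def t_def field_simps power2_eq_square)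
      then show ?thesis by simp
    qed simp
    then show ?thesis
      unfolding power2_norm_eq_inner m_def zk wk quad by (intro sum.cong refl)
  qed
  ultimately show thesis using that by blast
qed

end

section \<open>Jordan frames, the cone and the barrier\<close>

context euclidean_jordan_algebra
begin

lemma primitive_idempotentD:
  assumes "primitive_idempotent jp p"
  shows "idempotent jp p" "p \<noteq> 0" "p \<odot> p = p"
  using assms by (simp_all add: primitive_idempotent_def idempotent_def)

lemma jordan_frame_complete: "jordan_frame jp e F \<Longrightarrow> complete_idempotents F"
  unfolding jordan_frame_def complete_idempotents_def orthogonal_idempotents_def
  by (simp add: primitive_idempotentD)

lemma spectral_decomposition_iff:
  "spectral_decomposition jp e x F l \<longleftrightarrow> jordan_frame jp e F \<and> x = spec F l"
  by (simp add: spectral_decomposition_def spec_def)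

text \<open>
  The coefficients of an idempotent are \<open>0\<close> or \<open>1\<close>, and primitivity leaves exactly one \<open>1\<close>. So the
  trace of a primitive idempotent does not depend on the decomposition chosen.
\<close>

lemma primitive_idempotent_trace:
  assumes p: "primitive_idempotent jp p" and dec: "spectral_decomposition jp e p F l"
  shows "(\<Sum>q\<in>F. l q) = 1"
proof -
  have F: "complete_idempotents F" and pl: "p = spec F l"
    using dec jordan_frame_complete by (auto simp: spectral_decomposition_iff)
  have pp: "p \<odot> p = p" and p0: "p \<noteq> 0"
    using primitive_idempotentD[OF p] by auto
  have nz: "q \<noteq> 0" if "q \<in> F" for q
    using complete_orthogonal[OF F] that by (auto simp: orthogonal_idempotents_def)
  have l01: "l q = 0 \<or> l q = 1" if "q \<in> F" for q
  proof -
    have "(l q * l q) *\<^sub>R q = q \<odot> (p \<odot> p)"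
      using that by (simp add: pl spec_mult[OF F] spec_mult_right[OF F])
    also have "\<dots> = l q *\<^sub>R q"
      using that by (simp only: pp) (simp add: pl spec_mult_right[OF F])
    finally show ?thesis using nz[OF that] by auto
  qed
  define S where "S = {q \<in> F. l q = 1}"
  have "finite S" using complete_finite[OF F] by (simp add: S_def)
  have "p = (\<Sum>q\<in>F. if q \<in> S then q else 0)"
    unfolding pl spec_def S_def using l01 by (intro sum.cong) auto
  then have pS: "p = \<Sum>S"
    using complete_finite[OF F] by (simp add: S_def sum.If_cases Int_def)
  then obtain q where q: "q \<in> S" using p0 by fastforce
  have "S = {q}"
  proof (rule ccontr)
    assume "S \<noteq> {q}"
    then obtain r where r: "r \<in> S" "r \<noteq> q" using q by blast
    have o: "orthogonal_idempotents (S - {q})"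
      using complete_orthogonal[OF F] by (auto simp: orthogonal_idempotents_def S_def)
    have "r \<odot> \<Sum>(S - {q}) = r"
      using orthogonal_idempotents_mult_sum[OF o, of r "\<lambda>_. 1"] r by simp
    then have "\<Sum>(S - {q}) \<noteq> 0" using nz[of r] r by (auto simp: S_def)
    moreover have "p = q + \<Sum>(S - {q})"
      using pS sum.remove[OF \<open>finite S\<close> q, of "\<lambda>x. x"] by simp
    moreover have "idempotent jp q" "q \<noteq> 0"
      using q nz complete_idempotent[OF F] by (auto simp: S_def)
    ultimately show False
      using p idempotent_sum[OF o] unfolding primitive_idempotent_def by blast
  qed
  have "(\<Sum>q\<in>F. l q) = (\<Sum>q\<in>F. if q \<in> S then 1 else 0)"
    unfolding S_def using l01 by (intro sum.cong) auto
  also have "\<dots> = card S"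
    using complete_finite[OF F] by (simp add: S_def sum.If_cases Int_def)
  finally show ?thesis by (simp add: \<open>S = {q}\<close>)
qed

end

text \<open>
  The inner product is the trace form. It enters through the normalization of primitive
  idempotents to unit length.
\<close>

locale trace_jordan_algebra = euclidean_jordan_algebra jp e
  for jp :: "'e::euclidean_space \<Rightarrow> 'e \<Rightarrow> 'e" and e +
  assumes inner_trace: "inner x y = jordan_tr jp e (jp x y)"
begin

lemma primitive_idempotent_unit_norm:
  assumes "primitive_idempotent jp p"
  shows "inner p p = 1"
proof -
  have "jordan_tr jp e p = 1"
    unfolding jordan_tr_def
  proof (rule the_equality)
    show "\<exists>F l. spectral_decomposition jp e p F l \<and> 1 = (\<Sum>p\<in>F. l p)"
      using spectral_theorem[of p] primitive_idempotent_trace[OF assms] by metis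
  qed (use primitive_idempotent_trace[OF assms] in auto)
  then show ?thesis
    using assms by (simp add: inner_trace primitive_idempotentD)
qed

lemma frame_inner:
  assumes "jordan_frame jp e F" "p \<in> F" "q \<in> F"
  shows "inner p q = (if p = q then 1 else 0)"
proof (cases "p = q")
  case True
  then show ?thesis
    using assms primitive_idempotent_unit_norm by (simp add: jordan_frame_def)
next
  case False
  have "p \<odot> q = 0" using assms False by (simp add: jordan_frame_def)
  moreover have "idempotent jp p" "idempotent jp q"
    using assms by (simp_all add: jordan_frame_def primitive_idempotentD)
  ultimately show ?thesis using False idempotents_orthogonal_iff by simp
qed

lemma inner_spec_frame:
  assumes "jordan_frame jp e F" "p \<in> F"
  shows "inner (spec F f) p = f p"
proof -
  have "inner (spec F f) p = (\<Sum>q\<in>F. if q = p then f p else 0)"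
    unfolding spec_def inner_sum_left using frame_inner[OF assms(1) _ assms(2)]
    by (intro sum.cong) auto
  also have "\<dots> = f p" using assms by (simp add: jordan_frame_def)
  finally show ?thesis .
qed

lemma inner_spec_spec:
  assumes "jordan_frame jp e F"
  shows "inner (spec F f) (spec F g) = (\<Sum>p\<in>F. f p * g p)"
proof -
  have "inner (spec F f) (spec F g) = (\<Sum>p\<in>F. g p * inner (spec F f) p)"
    by (simp add: spec_def[of F g] inner_sum_right)
  then show ?thesis by (simp add: inner_spec_frame[OF assms] mult.commute)
qed

text \<open>
  In an orthonormal frame this is \<open>\<bar>\<Sum> l\<^sup>3\<bar> \<le> (\<Sum> l\<^sup>2)\<^bsup>3/2\<^esup>\<close>.
\<close>

lemma cube_le_norm_cube: "\<bar>inner (m \<odot> m) m\<bar> \<le> norm m ^ 3"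
proof -
  obtain F l where F: "jordan_frame jp e F" and m: "m = spec F l"
    using spectral_theorem[of m] by (metis spectral_decomposition_iff)
  have l: "\<bar>l p\<bar> \<le> norm m" if "p \<in> F" for p
  proof -
    have "\<bar>inner m p\<bar> \<le> norm m * norm p" by (rule Cauchy_Schwarz_ineq2)
    moreover have "norm p = 1" using frame_inner[OF F that that] by (simp add: norm_eq_1)
    ultimately show ?thesis by (simp add: m inner_spec_frame[OF F that])
  qed
  have "\<bar>inner (m \<odot> m) m\<bar> = \<bar>\<Sum>p\<in>F. l p * (l p)\<^sup>2\<bar>"
    by (simp add: m spec_mult[OF jordan_frame_complete[OF F]] inner_spec_spec[OF F] power2_eq_square mult_ac)
  also have "\<dots> \<le> (\<Sum>p\<in>F. \<bar>l p * (l p)\<^sup>2\<bar>)" by (rule sum_abs)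
  also have "\<dots> \<le> (\<Sum>p\<in>F. norm m * (l p)\<^sup>2)"
    unfolding abs_mult abs_power2 by (intro sum_mono mult_right_mono l) auto
  also have "\<dots> = norm m * (\<Sum>p\<in>F. (l p)\<^sup>2)" by (rule sum_distrib_left[symmetric])
  also have "(\<Sum>p\<in>F. (l p)\<^sup>2) = (norm m)\<^sup>2"
    by (simp add: power2_norm_eq_inner m inner_spec_spec[OF F]) (simp add: power2_eq_square)
  finally show ?thesis by (simp add: power3_eq_cube power2_eq_square)
qed

lemma frame_weights_nonneg:
  assumes "jordan_frame jp e F" "jordan_frame jp e G" "p \<in> F" "q \<in> G"
  shows "inner p q \<ge> 0"
  using assms by (simp add: jordan_frame_def primitive_idempotentD idempotents_inner_nonneg)

text \<open>
  For two frames, the matrix of inner products is doubly stochastic. Spectral functions of two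
  elements that do not commute can thus be compared term by term.
\<close>

lemma frame_weights_sum:
  assumes "jordan_frame jp e F" "jordan_frame jp e G" "p \<in> F"
  shows "(\<Sum>q\<in>G. inner p q) = 1"
proof -
  have "(\<Sum>q\<in>G. inner p q) = inner p e"
    using assms(2) by (simp add: jordan_frame_def flip: inner_sum_right)
  also have "\<dots> = inner p p"
    using assms(1,3) inner_jp_left[of p p e]
    by (simp add: jordan_frame_def primitive_idempotentD)
  finally show ?thesis using frame_inner[OF assms(1,3,3)] by simp
qed

lemma frame_weights_double_sum:
  assumes "jordan_frame jp e F" "jordan_frame jp e G"
  shows "(\<Sum>p\<in>F. \<Sum>q\<in>G. f p * inner p q) = (\<Sum>p\<in>F. f p)"
    and "(\<Sum>p\<in>F. \<Sum>q\<in>G. g q * inner p q) = (\<Sum>q\<in>G. g q)"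
proof -
  show "(\<Sum>p\<in>F. \<Sum>q\<in>G. f p * inner p q) = (\<Sum>p\<in>F. f p)"
    using frame_weights_sum[OF assms] by (simp flip: sum_distrib_left)
  show "(\<Sum>p\<in>F. \<Sum>q\<in>G. g q * inner p q) = (\<Sum>q\<in>G. g q)"
    using frame_weights_sum[OF assms(2,1)]
    by (subst sum.swap) (simp add: inner_commute flip: sum_distrib_left)
qed

text \<open>
  Forward: subtracting a small multiple of \<open>p\<close> stays in the cone, and squares have nonnegative inner
  product with \<open>p\<close>. Backward: the eigenvalues of a nearby element are, up to the distance, averages
  of the positive \<open>l p\<close>, by the weights above.
\<close>

lemma interior_cone_iff:
  assumes F: "jordan_frame jp e F"
  shows "spec F l \<in> interior (cone_of_squares jp) \<longleftrightarrow> (\<forall>p\<in>F. l p > 0)"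
proof
  assume "spec F l \<in> interior (cone_of_squares jp)"
  then obtain r where r: "r > 0" "cball (spec F l) r \<subseteq> cone_of_squares jp"
    using mem_interior_cball by blast
  show "\<forall>p\<in>F. l p > 0"
  proof
    fix p assume p: "p \<in> F"
    have "norm p = 1" using frame_inner[OF F p p] by (simp add: norm_eq_1)
    then have "spec F l - r *\<^sub>R p \<in> cball (spec F l) r" using r by (simp add: dist_norm)
    then have "spec F l - r *\<^sub>R p \<in> cone_of_squares jp" using r(2) by blast
    then obtain y where y: "spec F l - r *\<^sub>R p = y \<odot> y"
      unfolding cone_of_squares_def by blast
    have "0 \<le> inner p (y \<odot> y)"
      using F p by (simp add: jordan_frame_def primitive_idempotentD idempotent_inner_square_nonneg)
    then have "0 \<le> l p - r"
      using frame_inner[OF F p p]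
      by (simp flip: y) (simp add: inner_diff_right inner_commute[of p "spec F l"] inner_spec_frame[OF F p])
    then show "l p > 0" using r by simp
  qed
next
  assume pos: "\<forall>p\<in>F. l p > 0"
  have finF: "finite F" using F by (simp add: jordan_frame_def)
  obtain r where r: "r > 0" "\<And>p. p \<in> F \<Longrightarrow> r \<le> l p"
  proof (cases "F = {}")
    case False
    then show thesis
      using that[of "Min (l ` F)"] pos finF by simp
  qed (use that[of 1] in auto)
  have "ball (spec F l) r \<subseteq> cone_of_squares jp"
  proof
    fix y assume y: "y \<in> ball (spec F l) r"
    obtain G h where G: "jordan_frame jp e G" and yG: "y = spec G h"
      using spectral_theorem[of y] by (metis spectral_decomposition_iff)
    have h: "h q \<ge> 0" if q: "q \<in> G" for q
    proof -
      have nq: "norm q = 1" using frame_inner[OF G q q] by (simp add: norm_eq_1)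
      have "r * 1 = (\<Sum>p\<in>F. r * inner q p)"
        using frame_weights_sum[OF G F q] by (simp flip: sum_distrib_left)
      also have "\<dots> \<le> (\<Sum>p\<in>F. l p * inner q p)"
        using r frame_weights_nonneg[OF G F q] by (intro sum_mono mult_right_mono) auto
      also have "\<dots> = inner (spec F l) q"
        unfolding spec_def inner_sum_left by (simp add: inner_commute)
      also have "\<dots> = inner (spec F l - y) q + h q"
        by (simp add: inner_diff_left yG inner_spec_frame[OF G q])
      also have "inner (spec F l - y) q \<le> norm (spec F l - y)"
        using norm_cauchy_schwarz[of "spec F l - y" q] nq by simp
      finally show ?thesis using y by (simp add: dist_norm)
    qed
    have "y = spec G (\<lambda>q. sqrt (h q)) \<odot> spec G (\<lambda>q. sqrt (h q))"
      unfolding yG spec_mult[OF jordan_frame_complete[OF G]] using h by (simp add: spec_def)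
    then show "y \<in> cone_of_squares jp" by (auto simp: cone_of_squares_def)
  qed
  then show "spec F l \<in> interior (cone_of_squares jp)"
    using r(1) mem_interior by blast
qed

text \<open>
  The determinant is well defined on the interior of the cone: if \<open>F, l\<close> and \<open>G, h\<close> decompose the
  same element, \<open>l p\<close> and \<open>h q\<close> agree whenever \<open>\<langle>p, q\<rangle> \<noteq> 0\<close>, so the weighted double sums of the
  logarithms coincide.
\<close>

lemma log_det_barrier_spec:
  assumes F: "jordan_frame jp e F" and pos: "\<And>p. p \<in> F \<Longrightarrow> l p > 0"
  shows "log_det_barrier jp e (spec F l) = - (\<Sum>p\<in>F. ln (l p))"
proof -
  have "jordan_det jp e (spec F l) = (\<Prod>p\<in>F. l p)"
    unfolding jordan_det_def
  proof (rule the_equality)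
    show "\<exists>G h. spectral_decomposition jp e (spec F l) G h \<and> (\<Prod>p\<in>F. l p) = (\<Prod>p\<in>G. h p)"
      using F spectral_decomposition_iff by blast
    fix d assume "\<exists>G h. spectral_decomposition jp e (spec F l) G h \<and> d = (\<Prod>p\<in>G. h p)"
    then obtain G h where G: "jordan_frame jp e G" and eq: "spec F l = spec G h" and d: "d = (\<Prod>p\<in>G. h p)"
      by (auto simp: spectral_decomposition_iff)
    have hpos: "\<And>q. q \<in> G \<Longrightarrow> h q > 0"
      using interior_cone_iff[OF F, of l] interior_cone_iff[OF G, of h] pos by (simp add: eq)
    \<comment> \<open>Evaluate the product of \<open>p\<close>, \<open>q\<close> and the common element with either decomposition.\<close>
    have same: "ln (l p) * inner p q = ln (h q) * inner p q" if "p \<in> F" "q \<in> G" for p q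
    proof -
      have "inner (spec F l \<odot> p) q = inner p (spec F l \<odot> q)" by (rule inner_jp_left)
      then have "l p * inner p q = h q * inner p q"
        using that spec_mult_right[OF jordan_frame_complete[OF F]] spec_mult_right[OF jordan_frame_complete[OF G]]
        by (simp add: commute[of _ p] commute[of _ q]) (simp add: eq commute[of _ q])
      then show ?thesis by auto
    qed
    have "(\<Sum>p\<in>F. ln (l p)) = (\<Sum>p\<in>F. \<Sum>q\<in>G. ln (l p) * inner p q)"
      using frame_weights_double_sum(1)[OF F G] by simp
    also have "\<dots> = (\<Sum>p\<in>F. \<Sum>q\<in>G. ln (h q) * inner p q)"
      by (intro sum.cong refl same)
    also have "\<dots> = (\<Sum>q\<in>G. ln (h q))"
      by (rule frame_weights_double_sum(2)[OF F G])
    finally have "ln (\<Prod>p\<in>F. l p) = ln (\<Prod>q\<in>G. h q)"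
      using ln_prod[of F l] ln_prod[of G h] pos hpos F G by (simp add: jordan_frame_def less_imp_neq[symmetric])
    then show "d = (\<Prod>p\<in>F. l p)"
      using pos hpos by (simp add: d prod_pos)
  qed
  then show ?thesis
    using F pos ln_prod[of F l]
    by (simp add: log_det_barrier_def jordan_frame_def less_imp_neq[symmetric])
qed

text \<open>
  The tangent inequality of the convex barrier, whose gradient is minus the inverse, obtained
  without differentiation: it is the average of \<open>ln (h/l) \<le> h/l - 1\<close> with the weights \<open>\<langle>p, q\<rangle>\<close>.
\<close>

lemma log_det_barrier_gradient_inequality:
  assumes F: "jordan_frame jp e F" and pos: "\<And>p. p \<in> F \<Longrightarrow> l p > 0"
    and z: "z \<in> interior (cone_of_squares jp)"
  shows "log_det_barrier jp e z \<ge> log_det_barrier jp e (spec F l)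
    - inner (spec F (\<lambda>p. 1 / l p)) (z - spec F l)"
proof -
  obtain G h where G: "jordan_frame jp e G" and zG: "z = spec G h"
    using spectral_theorem[of z] by (metis spectral_decomposition_iff)
  have hpos: "\<And>q. q \<in> G \<Longrightarrow> h q > 0" using z interior_cone_iff[OF G] by (simp add: zG)
  have "0 \<le> (\<Sum>p\<in>F. \<Sum>q\<in>G. (ln (l p) - ln (h q) + h q / l p - 1) * inner p q)"
  proof (intro sum_nonneg mult_nonneg_nonneg frame_weights_nonneg[OF F G])
    fix p q assume "p \<in> F" "q \<in> G"
    then have "l p > 0" "h q > 0" using pos hpos by auto
    then show "0 \<le> ln (l p) - ln (h q) + h q / l p - 1"
      using ln_le_minus_one[of "h q / l p"] by (simp add: ln_div)
  qed
  also have "\<dots> = (\<Sum>p\<in>F. \<Sum>q\<in>G. ln (l p) * inner p q) - (\<Sum>p\<in>F. \<Sum>q\<in>G. ln (h q) * inner p q)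
      + (\<Sum>p\<in>F. \<Sum>q\<in>G. 1 / l p * (h q * inner p q)) - (\<Sum>p\<in>F. \<Sum>q\<in>G. 1 * inner p q)"
    by (simp add: algebra_simps sum.distrib sum_subtractf)
  also have "(\<Sum>p\<in>F. \<Sum>q\<in>G. 1 / l p * (h q * inner p q)) = inner (spec F (\<lambda>p. 1 / l p)) z"
    unfolding zG spec_def inner_sum_left inner_sum_right by (simp, rule sum.swap)
  also have "(\<Sum>p\<in>F. \<Sum>q\<in>G. 1 * inner p q) = (\<Sum>p\<in>F. 1)"
    by (rule frame_weights_double_sum(1)[OF F G])
  also have "\<dots> = (\<Sum>p\<in>F. 1 / l p * l p)"
    using pos by (intro sum.cong) (auto simp: less_imp_neq[symmetric])
  also have "\<dots> = inner (spec F (\<lambda>p. 1 / l p)) (spec F l)"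
    by (simp add: inner_spec_spec[OF F])
  finally show ?thesis
    using frame_weights_double_sum[OF F G, of "\<lambda>p. ln (l p)"] frame_weights_double_sum(2)[OF F G, of "\<lambda>q. ln (h q)"]
    by (simp add: log_det_barrier_spec[OF F pos] zG log_det_barrier_spec[OF G hpos] inner_diff_right)
qed

text \<open>
  Here \<open>z\<close> and \<open>w\<close> are inverse to each other up to the factor \<open>\<kappa>\<close>. The bound is
  \<open>\<bar>\<langle>m m, m\<rangle>\<bar> \<le> \<parallel>m\<parallel>\<^sup>3\<close> for the rescaled element \<open>m\<close>.
\<close>

lemma scaled_cubic_bound:
  assumes F: "jordan_frame jp e F" and pos: "\<And>p. p \<in> F \<Longrightarrow> f p > 0" and "\<kappa> > 0"
  defines "z \<equiv> spec F f" and "w \<equiv> spec F (\<lambda>p. \<kappa> / f p)"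
  shows "inner (z \<odot> k) (w \<odot> k) \<ge> 0"
    and "sqrt \<kappa> * \<bar>inner ((z \<odot> k) \<odot> (w \<odot> k)) k\<bar> \<le> inner (z \<odot> k) (w \<odot> k) powr (3/2)"
proof -
  note cF = jordan_frame_complete[OF F]
  define w1 where "w1 = spec F (\<lambda>p. 1 / f p)"
  have w: "w = \<kappa> *\<^sub>R w1" by (simp add: w_def w1_def spec_scale[OF cF])
  have r: "sqrt (f p) > 0" if "p \<in> F" for p using pos[OF that] by simp
  have eqs: "spec F (\<lambda>p. (sqrt (f p))\<^sup>2) = z" "spec F (\<lambda>p. 1 / (sqrt (f p))\<^sup>2) = w1"
    using pos by (auto simp: z_def w1_def spec_def less_imp_le intro!: sum.cong)
  obtain m where m: "inner (m \<odot> m) m = inner ((z \<odot> k) \<odot> (w1 \<odot> k)) k"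
    "(norm m)\<^sup>2 = inner (z \<odot> k) (w1 \<odot> k)"
    by (rule peirce_rescaling[where r = "\<lambda>p. sqrt (f p)" and k = k, OF cF r, unfolded eqs])
  have 1: "inner (z \<odot> k) (w \<odot> k) = \<kappa> * (norm m)\<^sup>2"
    and 2: "inner ((z \<odot> k) \<odot> (w \<odot> k)) k = \<kappa> * inner (m \<odot> m) m"
    by (simp_all add: w m)
  show "inner (z \<odot> k) (w \<odot> k) \<ge> 0" using \<open>\<kappa> > 0\<close> by (simp add: 1)
  have "(\<kappa> * (norm m)\<^sup>2) powr (3/2) = (sqrt \<kappa> * norm m) ^ 3"
  proof -
    have "\<kappa> * (norm m)\<^sup>2 = (sqrt \<kappa> * norm m) powr 2"
      using \<open>\<kappa> > 0\<close> by (cases "m = 0") (simp_all add: powr_numeral power_mult_distrib)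
    then have "(\<kappa> * (norm m)\<^sup>2) powr (3/2) = (sqrt \<kappa> * norm m) powr 3" by (simp add: powr_powr)
    then show ?thesis using \<open>\<kappa> > 0\<close> by (cases "m = 0") (simp_all add: powr_numeral)
  qed
  also have "\<dots> = sqrt \<kappa> * \<kappa> * norm m ^ 3"
    using \<open>\<kappa> > 0\<close> by (simp add: power3_eq_cube)
  finally show "sqrt \<kappa> * \<bar>inner ((z \<odot> k) \<odot> (w \<odot> k)) k\<bar> \<le> inner (z \<odot> k) (w \<odot> k) powr (3/2)"
    unfolding 1 2 using cube_le_norm_cube[of m] \<open>\<kappa> > 0\<close> by (simp add: abs_mult)
qed

end

section \<open>Functions with three derivatives\<close>

definition precompose :: "('a::real_normed_vector \<Rightarrow>\<^sub>L 'b::real_normed_vector)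
    \<Rightarrow> ('b \<Rightarrow>\<^sub>L 'c::real_normed_vector) \<Rightarrow>\<^sub>L ('a \<Rightarrow>\<^sub>L 'c)" where
  "precompose = bounded_bilinear.prod_left (o\<^sub>L)"

definition postcompose :: "('b::real_normed_vector \<Rightarrow>\<^sub>L 'c::real_normed_vector)
    \<Rightarrow> ('a::real_normed_vector \<Rightarrow>\<^sub>L 'b) \<Rightarrow>\<^sub>L ('a \<Rightarrow>\<^sub>L 'c)" where
  "postcompose = bounded_bilinear.prod_right (o\<^sub>L)"

lemma precompose_apply [simp]: "blinfun_apply (precompose l) g = g o\<^sub>L l"
  by (simp add: precompose_def bounded_bilinear.prod_left.rep_eq[OF bounded_bilinear_blinfun_compose])

lemma postcompose_apply [simp]: "blinfun_apply (postcompose l) g = l o\<^sub>L g"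
  by (simp add: postcompose_def bounded_bilinear.prod_right.rep_eq[OF bounded_bilinear_blinfun_compose])

lemma bounded_linear_precompose: "bounded_linear precompose"
  unfolding precompose_def
  by (rule bounded_bilinear.bounded_linear_prod_left[OF bounded_bilinear_blinfun_compose])

lemma bounded_linear_postcompose: "bounded_linear postcompose"
  unfolding postcompose_def
  by (rule bounded_bilinear.bounded_linear_prod_right[OF bounded_bilinear_blinfun_compose])

lemmas tendsto_blinfun_compose = bounded_bilinear.tendsto[OF bounded_bilinear_blinfun_compose]
lemmas continuous_on_blinfun_compose = bounded_bilinear.continuous_on[OF bounded_bilinear_blinfun_compose]

lemma blinfun_compose_assoc: "(f o\<^sub>L g) o\<^sub>L h = f o\<^sub>L (g o\<^sub>L h)"
  by (rule blinfun_eqI) simp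

text \<open>
  Explicit derivatives up to order three on the whole space; the predicate is closed under sums,
  multiples and affine substitution, and it determines \<open>D2\<close> and \<open>D3\<close>.
\<close>

definition has_jet3 :: "('a::real_normed_vector \<Rightarrow> real) \<Rightarrow> ('a \<Rightarrow> 'a \<Rightarrow>\<^sub>L real)
    \<Rightarrow> ('a \<Rightarrow> 'a \<Rightarrow>\<^sub>L ('a \<Rightarrow>\<^sub>L real)) \<Rightarrow> ('a \<Rightarrow> 'a \<Rightarrow>\<^sub>L ('a \<Rightarrow>\<^sub>L ('a \<Rightarrow>\<^sub>L real))) \<Rightarrow> bool"
where
  "has_jet3 f G1 G2 G3 \<longleftrightarrow>
     (\<forall>x. (f has_derivative blinfun_apply (G1 x)) (at x)) \<and>
     (\<forall>x. (G1 has_derivative blinfun_apply (G2 x)) (at x)) \<and>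
     (\<forall>x. (G2 has_derivative blinfun_apply (G3 x)) (at x)) \<and> continuous_on UNIV G3"

lemma fderiv_eqI:
  assumes "\<And>x. (f has_derivative blinfun_apply (G x)) (at x)"
  shows "fderiv f = G"
  unfolding fderiv_def
  using frechet_derivative_at[OF assms] by (simp add: blinfun_apply_inverse fun_eq_iff flip: frechet_derivative_at[OF assms])

lemma has_jet3_fderiv:
  assumes "has_jet3 f G1 G2 G3"
  shows "fderiv f = G1" "fderiv G1 = G2" "fderiv G2 = G3"
  using assms by (auto simp: has_jet3_def intro: fderiv_eqI)

lemma has_jet3_C3: "has_jet3 f G1 G2 G3 \<Longrightarrow> C3_on UNIV f"
  unfolding C3_on_def by (simp add: has_jet3_fderiv) (auto simp: has_jet3_def differentiable_def)

lemma has_jet3_D2: "has_jet3 f G1 G2 G3 \<Longrightarrow> D2 f x h = G2 x h h"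
  by (simp add: D2_def has_jet3_fderiv)

lemma has_jet3_D3: "has_jet3 f G1 G2 G3 \<Longrightarrow> D3 f x h = G3 x h h h"
  by (simp add: D3_def has_jet3_fderiv)

lemma has_jet3_add:
  assumes "has_jet3 f F1 F2 F3" "has_jet3 g G1 G2 G3"
  shows "has_jet3 (\<lambda>x. f x + g x) (\<lambda>x. F1 x + G1 x) (\<lambda>x. F2 x + G2 x) (\<lambda>x. F3 x + G3 x)"
  using assms unfolding has_jet3_def plus_blinfun.rep_eq
  by (auto intro!: has_derivative_add continuous_on_add)

lemma has_jet3_scale:
  assumes "has_jet3 f F1 F2 F3"
  shows "has_jet3 (\<lambda>x. r * f x) (\<lambda>x. r *\<^sub>R F1 x) (\<lambda>x. r *\<^sub>R F2 x) (\<lambda>x. r *\<^sub>R F3 x)"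
  using assms has_derivative_scaleR_right[of f _ _ r] unfolding has_jet3_def scaleR_blinfun.rep_eq
  by (auto intro!: has_derivative_scaleR_right continuous_intros)

text \<open>
  Each derivative of an affine substitution is again of this form, with \<open>M\<close> composing the inner
  arguments with \<open>l\<close>.
\<close>

lemma has_derivative_affine_sandwich:
  assumes "\<And>x. (g has_derivative blinfun_apply (G x)) (at x)"
  shows "((\<lambda>w. blinfun_apply M (g (a + blinfun_apply l w))) has_derivative
    blinfun_apply (M o\<^sub>L G (a + blinfun_apply l w) o\<^sub>L l)) (at w)"
proof -
  have "((\<lambda>w. a + blinfun_apply l w) has_derivative blinfun_apply l) (at w)"
    by (auto intro!: derivative_eq_intros bounded_linear_imp_has_derivative blinfun.bounded_linear_right)
  from has_derivative_compose[OF this assms]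
  have "((\<lambda>w. g (a + blinfun_apply l w)) has_derivative (\<lambda>h. G (a + blinfun_apply l w) (blinfun_apply l h))) (at w)" .
  from bounded_linear.has_derivative[OF blinfun.bounded_linear_right this, of M]
  show ?thesis by (rule has_derivative_eq_rhs) (simp add: fun_eq_iff)
qed

lemma has_jet3_affine:
  assumes "has_jet3 f G1 G2 G3"
  obtains H1 H2 H3 where "has_jet3 (\<lambda>w. f (a + blinfun_apply l w)) H1 H2 H3"
    and "\<And>w h k. H2 w h k = G2 (a + l w) (l h) (l k)"
    and "\<And>w h. H3 w h h h = G3 (a + l w) (l h) (l h) (l h)"
proof -
  define A where "A w = a + blinfun_apply l w" for w
  define M1 where "M1 = (precompose l :: _ \<Rightarrow>\<^sub>L (_ \<Rightarrow>\<^sub>L real))"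
  define M2 where "M2 = postcompose M1 o\<^sub>L precompose l"
  define H1 where "H1 w = blinfun_apply M1 (G1 (A w))" for w
  define H2 where "H2 w = blinfun_apply M2 (G2 (A w))" for w
  define H3 where "H3 w = M2 o\<^sub>L G3 (A w) o\<^sub>L l" for w
  have cA: "continuous_on UNIV A"
    unfolding A_def by (intro continuous_intros)
  have jet: "\<And>x. (f has_derivative blinfun_apply (G1 x)) (at x)" "\<And>x. (G1 has_derivative blinfun_apply (G2 x)) (at x)"
    "\<And>x. (G2 has_derivative blinfun_apply (G3 x)) (at x)" "continuous_on UNIV G3"
    using assms by (auto simp: has_jet3_def)
  have "((\<lambda>w. f (A w)) has_derivative H1 w) (at w)" for w
    using has_derivative_affine_sandwich[OF jet(1), of id_blinfun a l w]
    by (simp add: H1_def M1_def A_def blinfun_eqI[of "id_blinfun o\<^sub>L _"])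
  moreover have "(H1 has_derivative H2 w) (at w)" for w
    using has_derivative_affine_sandwich[OF jet(2), of M1 a l w]
    by (simp add: H1_def[abs_def] H2_def M2_def A_def blinfun_compose_assoc)
  moreover have "(H2 has_derivative H3 w) (at w)" for w
    using has_derivative_affine_sandwich[OF jet(3), of M2 a l w]
    by (simp add: H2_def[abs_def] H3_def A_def)
  moreover have "continuous_on UNIV H3"
    unfolding H3_def
    by (intro continuous_on_blinfun_compose continuous_on_const continuous_on_compose2[OF jet(4) cA]) auto
  ultimately have "has_jet3 (\<lambda>w. f (a + blinfun_apply l w)) H1 H2 H3"
    by (simp add: has_jet3_def A_def)
  then show thesis
    by (rule that) (simp_all add: H2_def H3_def M2_def M1_def A_def)
qed

lemma has_jet3_linear: "has_jet3 (\<lambda>x. c + blinfun_apply l x) (\<lambda>_. l) (\<lambda>_. 0) (\<lambda>_. 0)"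
  unfolding has_jet3_def
  by (auto intro!: derivative_eq_intros bounded_linear_imp_has_derivative blinfun.bounded_linear_right)

definition inner_blinfun :: "'a::real_inner \<Rightarrow>\<^sub>L ('a \<Rightarrow>\<^sub>L real)" where
  "inner_blinfun = Blinfun blinfun_inner_right"

lemma inner_blinfun_apply [simp]: "blinfun_apply (blinfun_apply inner_blinfun x) y = inner x y"
  by (simp add: inner_blinfun_def bounded_linear_Blinfun_apply bounded_linear_blinfun_inner_right)

lemma has_jet3_norm_square:
  "has_jet3 (\<lambda>x. (norm x)\<^sup>2) (\<lambda>x. 2 *\<^sub>R blinfun_apply inner_blinfun x) (\<lambda>_. 2 *\<^sub>R inner_blinfun) (\<lambda>_. 0)"
proof -
  have "((\<lambda>x. (norm x)\<^sup>2) has_derivative blinfun_apply (2 *\<^sub>R blinfun_apply inner_blinfun x)) (at x)" for x :: 'a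
    unfolding power2_norm_eq_inner
    by (auto intro!: derivative_eq_intros simp: blinfun.scaleR_left inner_commute)
  moreover have "((\<lambda>x. 2 *\<^sub>R blinfun_apply inner_blinfun x) has_derivative blinfun_apply (2 *\<^sub>R inner_blinfun)) (at x)" for x :: 'a
    unfolding blinfun.scaleR_left[symmetric]
    by (rule bounded_linear_imp_has_derivative[OF blinfun.bounded_linear_right])
  ultimately show ?thesis by (simp add: has_jet3_def zero_blinfun.rep_eq)
qed

lemma has_jet3_convex:
  assumes jet: "has_jet3 f G1 G2 G3" and nonneg: "\<And>x h. G2 x h h \<ge> 0"
  shows "convex_on UNIV f"
proof (rule convex_onI)
  fix t :: real and x y assume t: "0 < t" "t < 1"
  define g where "g r = f (x + r *\<^sub>R (y - x))" for r :: real
  have "(g has_real_derivative G1 (x + r *\<^sub>R (y - x)) (y - x)) (at r)" for r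
  proof -
    have "((\<lambda>r. x + r *\<^sub>R (y - x)) has_derivative (\<lambda>r. r *\<^sub>R (y - x))) (at r)"
      by (auto intro!: derivative_eq_intros)
    from has_derivative_compose[OF this, of f "G1 (x + r *\<^sub>R (y - x))"] jet
    have "(g has_derivative (\<lambda>h. G1 (x + r *\<^sub>R (y - x)) (h *\<^sub>R (y - x)))) (at r)"
      by (simp add: has_jet3_def g_def[abs_def])
    then show ?thesis
      by (rule has_derivative_imp_has_field_derivative) (simp add: blinfun.scaleR_right)
  qed
  moreover have "((\<lambda>r. G1 (x + r *\<^sub>R (y - x)) (y - x)) has_real_derivative G2 (x + r *\<^sub>R (y - x)) (y - x) (y - x)) (at r)" for r
  proof -
    have "((\<lambda>r. x + r *\<^sub>R (y - x)) has_derivative (\<lambda>r. r *\<^sub>R (y - x))) (at r)"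
      by (auto intro!: derivative_eq_intros)
    from has_derivative_compose[OF this, of G1 "G2 (x + r *\<^sub>R (y - x))"] jet
    have "((\<lambda>r. G1 (x + r *\<^sub>R (y - x))) has_derivative (\<lambda>h. G2 (x + r *\<^sub>R (y - x)) (h *\<^sub>R (y - x)))) (at r)"
      by (auto simp: has_jet3_def)
    from bounded_linear.has_derivative[OF blinfun.bounded_linear_left this]
    show ?thesis
      by (rule has_derivative_imp_has_field_derivative) (simp add: blinfun.scaleR_right blinfun.scaleR_left)
  qed
  ultimately have "convex_on UNIV g"
    by (rule f''_ge0_imp_convex[OF convex_UNIV]) (rule nonneg)
  from convex_onD[OF this, of t 0 1] t
  have "g t \<le> (1 - t) * g 0 + t * g 1" by simp
  then show "f ((1 - t) *\<^sub>R x + t *\<^sub>R y) \<le> (1 - t) * f x + t * f y"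
    by (simp add: g_def algebra_simps)
qed simp

text \<open>
  Differentiability from a difference quotient that is continuous in operator norm. It gives the
  derivatives of the square root and of operator inverses directly from algebraic identities.
\<close>

lemma caratheodory_has_derivative:
  fixes f :: "'a::real_normed_vector \<Rightarrow> 'b::real_normed_vector"
  assumes Q: "\<And>y. f y - f x = blinfun_apply (Q y) (y - x)" and lim: "(Q \<longlongrightarrow> Q x) (at x)"
  shows "(f has_derivative blinfun_apply (Q x)) (at x)"
proof (rule has_derivativeI_sandwich[of 1])
  show "((\<lambda>y. norm (Q y - Q x)) \<longlongrightarrow> 0) (at x)"
    using lim by (simp add: tendsto_norm_zero_iff LIM_zero_iff)
  show "norm (f y - f x - Q x (y - x)) / norm (y - x) \<le> norm (Q y - Q x)" if "y \<noteq> x" for y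
    using norm_blinfun[of "Q y - Q x" "y - x"] that
    by (simp add: Q blinfun.diff_left divide_le_eq)
qed (simp_all add: blinfun.bounded_linear_right)

section \<open>The square root of \<open>y\<^sup>2 + 4 \<kappa> e\<close>\<close>

lemma coercive_has_inverse:
  fixes f :: "'a::euclidean_space \<Rightarrow> 'a"
  assumes f: "linear f" and c: "c > 0" and coercive: "\<And>v. c * (norm v)\<^sup>2 \<le> inner (f v) v"
  obtains R :: "'a \<Rightarrow>\<^sub>L 'a" where "\<And>v. f (R v) = v" "\<And>v. R (f v) = v" "norm R \<le> 1 / c"
proof -
  have low: "c * norm v \<le> norm (f v)" for v
  proof (cases "v = 0")
    case False
    have "c * (norm v)\<^sup>2 \<le> norm (f v) * norm v"
      using coercive[of v] norm_cauchy_schwarz[of "f v" v] by linarith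
    then show ?thesis using False by (simp add: power2_eq_square)
  qed (simp add: linear_0[OF f])
  have inj: "inj f"
    using low c by (auto simp: linear_injective_0[OF f]) (metis low mult_le_0_iff norm_le_zero_iff norm_zero not_le)
  then obtain g where g: "linear g" "\<And>v. f (g v) = v" "\<And>v. g (f v) = v"
    using linear_injective_isomorphism[OF f inj] by blast
  have bg: "bounded_linear g" using g(1) by (simp add: linear_conv_bounded_linear)
  have "norm (Blinfun g) \<le> 1 / c"
  proof (rule norm_blinfun_bound)
    show "norm (Blinfun g v) \<le> 1 / c * norm v" for v
      using low[of "g v"] c by (simp add: bounded_linear_Blinfun_apply[OF bg] g(2) field_simps)
  qed (use c in simp)
  then show thesis
    using that[of "Blinfun g"] g by (simp add: bounded_linear_Blinfun_apply[OF bg])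
qed

context euclidean_jordan_algebra
begin

lemma bounded_linear_jp: "bounded_linear ((\<odot>) x)"
  using linear_jp by (simp add: linear_conv_bounded_linear)

lemma tendsto_jp: "(f \<longlongrightarrow> a) F \<Longrightarrow> (g \<longlongrightarrow> b) F \<Longrightarrow> ((\<lambda>x. f x \<odot> g x) \<longlongrightarrow> a \<odot> b) F"
  using bilinear unfolding bilinear_conv_bounded_bilinear by (rule bounded_bilinear.tendsto)

definition Lmult :: "'e \<Rightarrow>\<^sub>L ('e \<Rightarrow>\<^sub>L 'e)" where
  "Lmult = Blinfun (\<lambda>x. Blinfun ((\<odot>) x))"

lemma Lmult_apply [simp]: "blinfun_apply (blinfun_apply Lmult x) v = x \<odot> v"
proof -
  have "linear (\<lambda>x. Blinfun ((\<odot>) x))"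
    by (rule linearI; rule blinfun_eqI)
      (simp_all add: bounded_linear_Blinfun_apply[OF bounded_linear_jp] jp_add_left blinfun.add_left blinfun.scaleR_left)
  then show ?thesis
    by (simp add: Lmult_def bounded_linear_Blinfun_apply linear_conv_bounded_linear
        bounded_linear_Blinfun_apply[OF bounded_linear_jp])
qed

definition mult_coercive :: "real \<Rightarrow> 'e \<Rightarrow> bool" where
  "mult_coercive r a \<longleftrightarrow> r > 0 \<and> (\<forall>v. r * (norm v)\<^sup>2 \<le> inner (a \<odot> v) v)"

definition mult_inv :: "'e \<Rightarrow> 'e \<Rightarrow>\<^sub>L 'e" where
  "mult_inv a = (SOME R :: 'e \<Rightarrow>\<^sub>L 'e. (\<forall>v. a \<odot> blinfun_apply R v = v) \<and> (\<forall>v. blinfun_apply R (a \<odot> v) = v))"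

lemma mult_inv:
  assumes "mult_coercive r a"
  shows "a \<odot> mult_inv a v = v" "mult_inv a (a \<odot> v) = v" "norm (mult_inv a) \<le> 1 / r"
proof -
  obtain R :: "'e \<Rightarrow>\<^sub>L 'e" where R: "\<And>v. a \<odot> R v = v" "\<And>v. R (a \<odot> v) = v" "norm R \<le> 1 / r"
    using coercive_has_inverse[OF linear_jp, of r a] assms unfolding mult_coercive_def by blast
  have "\<exists>R. (\<forall>v. a \<odot> blinfun_apply R v = v) \<and> (\<forall>v. blinfun_apply R (a \<odot> v) = v)" using R by blast
  from someI_ex[OF this]
  have *: "\<And>v. a \<odot> mult_inv a v = v" "\<And>v. mult_inv a (a \<odot> v) = v"
    unfolding mult_inv_def by blast+
  have "mult_inv a = R" by (rule blinfun_eqI) (metis * R)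
  then show "a \<odot> mult_inv a v = v" "mult_inv a (a \<odot> v) = v" "norm (mult_inv a) \<le> 1 / r"
    using * R by auto
qed

text \<open>
  The resolvent identity, which is the difference quotient of the inverse.
\<close>

lemma mult_inv_diff:
  assumes "mult_coercive r a" "mult_coercive r b"
  shows "mult_inv b - mult_inv a = - (mult_inv b o\<^sub>L Lmult (b - a) o\<^sub>L mult_inv a)"
proof (rule blinfun_eqI)
  fix v
  have "mult_inv b ((b - a) \<odot> mult_inv a v) = mult_inv a v - mult_inv b v"
    by (simp add: jp_diff_left blinfun.diff_right mult_inv[OF assms(1)] mult_inv[OF assms(2)])
  then show "(mult_inv b - mult_inv a) v = (- (mult_inv b o\<^sub>L Lmult (b - a) o\<^sub>L mult_inv a)) v"
    by (simp add: blinfun.diff_left blinfun.minus_left)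
qed

lemma mult_inv_self_adjoint:
  assumes "mult_coercive r a"
  shows "inner (mult_inv a u) v = inner u (mult_inv a v)"
  by (metis inner_jp_left mult_inv(1)[OF assms])

lemma tendsto_mult_inv:
  assumes g: "(g \<longlongrightarrow> a) F" and a: "mult_coercive r a" and "\<And>y. mult_coercive r (g y)"
  shows "((\<lambda>y. mult_inv (g y)) \<longlongrightarrow> mult_inv a) F"
proof -
  have "norm (mult_inv (g y) - mult_inv a) \<le> 1 / r * norm (Lmult (g y - a)) * (1 / r)" for y
  proof -
    have "norm (mult_inv (g y) - mult_inv a) \<le> norm (mult_inv (g y)) * norm (Lmult (g y - a)) * norm (mult_inv a)"
      unfolding mult_inv_diff[OF a assms(3)] norm_minus_cancel
      by (meson norm_blinfun_compose mult_right_mono norm_ge_zero order_trans)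
    also have "\<dots> \<le> 1 / r * norm (Lmult (g y - a)) * (1 / r)"
      using a assms(3) by (intro mult_mono mult_inv) (auto simp: mult_coercive_def less_imp_le)
    finally show ?thesis .
  qed
  moreover have "((\<lambda>y. 1 / r * norm (Lmult (g y - a)) * (1 / r)) \<longlongrightarrow> 1 / r * norm (Lmult (a - a)) * (1 / r)) F"
    by (intro tendsto_intros g)
  ultimately show ?thesis
    using Lim_null_comparison[of "\<lambda>y. mult_inv (g y) - mult_inv a" "\<lambda>y. 1 / r * norm (Lmult (g y - a)) * (1 / r)" F]
    by (simp add: Lim_null[of _ "mult_inv a"] blinfun.zero_right)
qed

text \<open>
  The square root of \<open>y\<^sup>2 + 4 \<kappa> e\<close>, with respect to a chosen spectral decomposition of \<open>y\<close>. As
  the decomposition is a choice, the root is handled through its square, its coercivity and its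
  commutation with \<open>y\<close>.
\<close>

definition shifted_sqrt :: "real \<Rightarrow> 'e \<Rightarrow> 'e" where
  "shifted_sqrt \<kappa> y = (SOME s. \<exists>F l. jordan_frame jp e F \<and> y = spec F l
     \<and> s = spec F (\<lambda>p. sqrt ((l p)\<^sup>2 + 4 * \<kappa>)))"

lemma shifted_sqrt_spec:
  obtains F l where "jordan_frame jp e F" "y = spec F l"
    "shifted_sqrt \<kappa> y = spec F (\<lambda>p. sqrt ((l p)\<^sup>2 + 4 * \<kappa>))"
proof -
  have "\<exists>s F l. jordan_frame jp e F \<and> y = spec F l \<and> s = spec F (\<lambda>p. sqrt ((l p)\<^sup>2 + 4 * \<kappa>))"
    using spectral_theorem[of y] by (metis spectral_decomposition_iff)
  from someI_ex[OF this] show thesis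
    using that unfolding shifted_sqrt_def by blast
qed

context
  fixes \<kappa> :: real assumes \<kappa>: "\<kappa> > 0"
begin

lemma shifted_sqrt_square: "shifted_sqrt \<kappa> y \<odot> shifted_sqrt \<kappa> y = y \<odot> y + (4 * \<kappa>) *\<^sub>R e"
proof -
  obtain F l where F: "jordan_frame jp e F" "y = spec F l" "shifted_sqrt \<kappa> y = spec F (\<lambda>p. sqrt ((l p)\<^sup>2 + 4 * \<kappa>))"
    by (rule shifted_sqrt_spec)
  note cF = jordan_frame_complete[OF F(1)]
  show ?thesis
    using \<kappa> unfolding F(3) unfolding F(2) spec_mult[OF cF] spec_const[OF cF, symmetric] spec_add[OF cF]
    by (simp add: power2_eq_square)
qed

lemma shifted_sqrt_coercive: "mult_coercive (2 * sqrt \<kappa>) (shifted_sqrt \<kappa> y)"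
proof -
  obtain F l where F: "jordan_frame jp e F" "y = spec F l" "shifted_sqrt \<kappa> y = spec F (\<lambda>p. sqrt ((l p)\<^sup>2 + 4 * \<kappa>))"
    by (rule shifted_sqrt_spec)
  have "2 * sqrt \<kappa> \<le> sqrt ((l p)\<^sup>2 + 4 * \<kappa>)" for p
    using real_sqrt_le_mono[of "4 * \<kappa>" "(l p)\<^sup>2 + 4 * \<kappa>"] by (simp add: real_sqrt_mult)
  then show ?thesis
    using \<kappa> spec_coercive[OF jordan_frame_complete[OF F(1)]] by (simp add: F(3) mult_coercive_def)
qed

lemma shifted_sqrt_commute: "shifted_sqrt \<kappa> y \<odot> (y \<odot> v) = y \<odot> (shifted_sqrt \<kappa> y \<odot> v)"
proof -
  obtain F l where F: "jordan_frame jp e F" "y = spec F l" "shifted_sqrt \<kappa> y = spec F (\<lambda>p. sqrt ((l p)\<^sup>2 + 4 * \<kappa>))"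
    by (rule shifted_sqrt_spec)
  show ?thesis unfolding F(3) by (subst (1 2) F(2)) (rule spec_commute[OF jordan_frame_complete[OF F(1)]])
qed

lemma sum_shifted_sqrt_coercive: "mult_coercive (4 * sqrt \<kappa>) (shifted_sqrt \<kappa> y + shifted_sqrt \<kappa> x)"
proof -
  have "4 * sqrt \<kappa> * (norm v)\<^sup>2 \<le> inner ((shifted_sqrt \<kappa> y + shifted_sqrt \<kappa> x) \<odot> v) v" for v
  proof -
    have "2 * sqrt \<kappa> * (norm v)\<^sup>2 \<le> inner (shifted_sqrt \<kappa> y \<odot> v) v" "2 * sqrt \<kappa> * (norm v)\<^sup>2 \<le> inner (shifted_sqrt \<kappa> x \<odot> v) v"
      using shifted_sqrt_coercive unfolding mult_coercive_def by blast+
    then show ?thesis by (simp add: jp_add_left inner_add_left)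
  qed
  then show ?thesis using \<kappa> by (simp add: mult_coercive_def)
qed

text \<open>
  The difference quotient of the square root: \<open>(s y + s x) (s y - s x) = (y + x) (y - x)\<close>, and
  multiplication by \<open>s y + s x\<close> is invertible with a bound that is uniform in \<open>x\<close> and \<open>y\<close>.
\<close>

definition sqrt_slope :: "'e \<Rightarrow> 'e \<Rightarrow> 'e \<Rightarrow>\<^sub>L 'e" where
  "sqrt_slope x y = mult_inv (shifted_sqrt \<kappa> y + shifted_sqrt \<kappa> x) o\<^sub>L Lmult (y + x)"

lemma shifted_sqrt_difference: "shifted_sqrt \<kappa> y - shifted_sqrt \<kappa> x = sqrt_slope x y (y - x)"
proof -
  have "(shifted_sqrt \<kappa> y + shifted_sqrt \<kappa> x) \<odot> (shifted_sqrt \<kappa> y - shifted_sqrt \<kappa> x) = shifted_sqrt \<kappa> y \<odot> shifted_sqrt \<kappa> y - shifted_sqrt \<kappa> x \<odot> shifted_sqrt \<kappa> x"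
    by (simp add: jp_linear commute[of "shifted_sqrt \<kappa> x" "shifted_sqrt \<kappa> y"])
  also have "\<dots> = (y + x) \<odot> (y - x)"
    by (simp add: jp_linear commute[of x y] shifted_sqrt_square)
  finally show ?thesis
    using mult_inv(2)[OF sum_shifted_sqrt_coercive, of y x "shifted_sqrt \<kappa> y - shifted_sqrt \<kappa> x"] by (simp add: sqrt_slope_def)
qed

lemma isCont_shifted_sqrt: "isCont (shifted_sqrt \<kappa>) x"
proof -
  let ?h = "\<lambda>y. 1 / (4 * sqrt \<kappa>) * norm ((y + x) \<odot> (y - x))"
  have "norm (shifted_sqrt \<kappa> y - shifted_sqrt \<kappa> x) \<le> ?h y" for y
  proof -
    have "norm (shifted_sqrt \<kappa> y - shifted_sqrt \<kappa> x) \<le> norm (mult_inv (shifted_sqrt \<kappa> y + shifted_sqrt \<kappa> x)) * norm ((y + x) \<odot> (y - x))"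
      unfolding shifted_sqrt_difference sqrt_slope_def by (simp add: norm_blinfun)
    also have "\<dots> \<le> 1 / (4 * sqrt \<kappa>) * norm ((y + x) \<odot> (y - x))"
      by (intro mult_right_mono mult_inv(3)[OF sum_shifted_sqrt_coercive] norm_ge_zero)
    finally show ?thesis .
  qed
  moreover have "(?h \<longlongrightarrow> 0) (at x)"
  proof -
    have "((\<lambda>y. (y + x) \<odot> (y - x)) \<longlongrightarrow> (x + x) \<odot> (x - x)) (at x)"
      by (intro tendsto_jp tendsto_add tendsto_diff tendsto_ident_at tendsto_const)
    then show ?thesis
      by (intro tendsto_mult_right_zero tendsto_norm_zero) simp
  qed
  ultimately have "((\<lambda>y. shifted_sqrt \<kappa> y - shifted_sqrt \<kappa> x) \<longlongrightarrow> 0) (at x)"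
    by (rule Lim_null_comparison[OF always_eventually[OF allI]])
  then show ?thesis by (simp add: isCont_def LIM_zero_iff)
qed

definition double_inv :: "'e \<Rightarrow> 'e \<Rightarrow>\<^sub>L 'e" where "double_inv y = mult_inv (shifted_sqrt \<kappa> y + shifted_sqrt \<kappa> y)"

lemma continuous_on_double_inv: "continuous_on UNIV double_inv"
  unfolding continuous_on_def double_inv_def
  by (intro ballI tendsto_mult_inv[where r = "4 * sqrt \<kappa>"] sum_shifted_sqrt_coercive tendsto_add)
    (simp_all add: isContD[OF isCont_shifted_sqrt])

lemma tendsto_sqrt_slope: "(sqrt_slope x \<longlongrightarrow> sqrt_slope x x) (at x)"
  unfolding sqrt_slope_def
  by (intro tendsto_blinfun_compose tendsto_mult_inv[where r = "4 * sqrt \<kappa>"] sum_shifted_sqrt_coercive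
      tendsto_add tendsto_const isContD[OF isCont_shifted_sqrt] blinfun.tendsto tendsto_ident_at)

definition sqrt_deriv :: "'e \<Rightarrow> 'e \<Rightarrow>\<^sub>L 'e" where
  "sqrt_deriv y = double_inv y o\<^sub>L Lmult (y + y)"

lemma sqrt_slope_self: "sqrt_slope x x = sqrt_deriv x"
  by (simp add: sqrt_slope_def sqrt_deriv_def double_inv_def)

lemma shifted_sqrt_has_derivative: "(shifted_sqrt \<kappa> has_derivative blinfun_apply (sqrt_deriv x)) (at x)"
  using caratheodory_has_derivative[OF shifted_sqrt_difference tendsto_sqrt_slope]
  by (simp add: sqrt_slope_self)

definition double_inv_deriv :: "'e \<Rightarrow> 'e \<Rightarrow>\<^sub>L ('e \<Rightarrow>\<^sub>L 'e)" where
  "double_inv_deriv y = - (postcompose (double_inv y) o\<^sub>L (precompose (double_inv y)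
      o\<^sub>L (Lmult o\<^sub>L (2 *\<^sub>R sqrt_deriv y))))"

lemma double_inv_has_derivative: "(double_inv has_derivative blinfun_apply (double_inv_deriv x)) (at x)"
proof -
  define Q where "Q y = - (postcompose (double_inv y) o\<^sub>L (precompose (double_inv x)
      o\<^sub>L (Lmult o\<^sub>L (2 *\<^sub>R sqrt_slope x y))))" for y
  have "double_inv y - double_inv x = Q y (y - x)" for y
  proof -
    have "shifted_sqrt \<kappa> y + shifted_sqrt \<kappa> y - (shifted_sqrt \<kappa> x + shifted_sqrt \<kappa> x) = 2 *\<^sub>R sqrt_slope x y (y - x)"
      by (simp add: scaleR_2 flip: shifted_sqrt_difference)
    then show ?thesis
      unfolding double_inv_def mult_inv_diff[OF sum_shifted_sqrt_coercive sum_shifted_sqrt_coercive] Q_def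
      by (simp add: blinfun.minus_left blinfun.scaleR_left blinfun_compose_assoc)
  qed
  moreover have "(Q \<longlongrightarrow> Q x) (at x)"
  proof -
    have "(double_inv \<longlongrightarrow> double_inv x) (at x)"
      using continuous_on_double_inv by (simp add: continuous_on_def)
    then show ?thesis
      unfolding Q_def
      by (intro tendsto_minus tendsto_scaleR tendsto_const tendsto_blinfun_compose tendsto_sqrt_slope
          bounded_linear.tendsto[OF bounded_linear_postcompose])
  qed
  ultimately have "(double_inv has_derivative blinfun_apply (Q x)) (at x)"
    by (rule caratheodory_has_derivative)
  then show ?thesis by (simp add: Q_def double_inv_deriv_def sqrt_slope_self)
qed

definition sqrt_deriv2 :: "'e \<Rightarrow> 'e \<Rightarrow>\<^sub>L ('e \<Rightarrow>\<^sub>L 'e)" where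
  "sqrt_deriv2 y = (precompose (Lmult (y + y)) o\<^sub>L double_inv_deriv y) + (postcompose (double_inv y) o\<^sub>L (2 *\<^sub>R Lmult))"

lemma sqrt_deriv_has_derivative: "(sqrt_deriv has_derivative blinfun_apply (sqrt_deriv2 x)) (at x)"
proof -
  have "((\<lambda>y. Lmult (y + y)) has_derivative (\<lambda>h. Lmult (h + h))) (at x)"
    by (intro bounded_linear.has_derivative[OF blinfun.bounded_linear_right] derivative_intros)
  from bounded_bilinear.FDERIV[OF bounded_bilinear_blinfun_compose double_inv_has_derivative this]
  show ?thesis
    unfolding sqrt_deriv_def
    by (rule has_derivative_eq_rhs)
      (simp add: sqrt_deriv2_def fun_eq_iff blinfun.add_left blinfun.scaleR_left scaleR_2 blinfun.add_right
        bounded_bilinear.add_right[OF bounded_bilinear_blinfun_compose] add.commute)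
qed

lemma continuous_on_sqrt_deriv2: "continuous_on UNIV sqrt_deriv2"
proof -
  have 1: "continuous_on UNIV sqrt_deriv"
    unfolding sqrt_deriv_def
    by (intro continuous_on_blinfun_compose continuous_on_double_inv continuous_intros)
  have 2: "continuous_on UNIV double_inv_deriv"
    unfolding double_inv_deriv_def
    by (intro continuous_on_blinfun_compose continuous_on_double_inv 1 continuous_intros
        bounded_linear.continuous_on[OF bounded_linear_postcompose] bounded_linear.continuous_on[OF bounded_linear_precompose])
  show ?thesis
    unfolding sqrt_deriv2_def
    by (intro continuous_on_blinfun_compose continuous_on_double_inv 2 continuous_intros
        bounded_linear.continuous_on[OF bounded_linear_postcompose] bounded_linear.continuous_on[OF bounded_linear_precompose])
qed

text \<open>
  Directions are written as \<open>s y \<odot> k\<close>; in this coordinate all derivatives become products with \<open>k\<close>.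
\<close>

lemma sqrt_deriv_apply: "sqrt_deriv y (shifted_sqrt \<kappa> y \<odot> k) = y \<odot> k"
proof -
  have "(y + y) \<odot> (shifted_sqrt \<kappa> y \<odot> k) = (shifted_sqrt \<kappa> y + shifted_sqrt \<kappa> y) \<odot> (y \<odot> k)"
    by (simp add: jp_add_left shifted_sqrt_commute)
  then show ?thesis
    by (simp add: sqrt_deriv_def double_inv_def mult_inv(2)[OF sum_shifted_sqrt_coercive])
qed

lemma double_inv_apply: "double_inv y (shifted_sqrt \<kappa> y \<odot> k) = (1/2) *\<^sub>R k"
  using mult_inv(2)[OF sum_shifted_sqrt_coercive, of y y "(1/2) *\<^sub>R k"]
  by (simp add: double_inv_def jp_add_left flip: scaleR_2 scaleR_add_left)

text \<open>
  Differentiating \<open>s\<^sup>2 = y\<^sup>2 + 4 \<kappa> e\<close> twice in the direction \<open>h = s k\<close> gives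
  \<open>2 s (D\<^sup>2s[h,h]) = 2 (h\<^sup>2 - (y k)\<^sup>2)\<close>, and the right-hand side factors into the two products shown.
\<close>

lemma sqrt_deriv2_inner:
  "inner (sqrt_deriv2 y (shifted_sqrt \<kappa> y \<odot> k) (shifted_sqrt \<kappa> y \<odot> k)) (shifted_sqrt \<kappa> y \<odot> k)
    = inner ((shifted_sqrt \<kappa> y - y) \<odot> k \<odot> ((shifted_sqrt \<kappa> y + y) \<odot> k)) k"
proof -
  let ?h = "shifted_sqrt \<kappa> y \<odot> k"
  have "sqrt_deriv2 y ?h ?h = double_inv y (2 *\<^sub>R (?h \<odot> ?h - (y \<odot> k) \<odot> (y \<odot> k)))"
  proof -
    have "double_inv y ((y + y) \<odot> ?h) = y \<odot> k"
      using sqrt_deriv_apply[of y k] by (simp add: sqrt_deriv_def)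
    then show ?thesis
      by (simp add: sqrt_deriv2_def double_inv_deriv_def blinfun.add_left blinfun.minus_left
          blinfun.scaleR_left blinfun.scaleR_right blinfun.diff_right sqrt_deriv_apply algebra_simps)
  qed
  moreover have "?h \<odot> ?h - (y \<odot> k) \<odot> (y \<odot> k) = ((shifted_sqrt \<kappa> y - y) \<odot> k) \<odot> ((shifted_sqrt \<kappa> y + y) \<odot> k)"
    by (simp add: jp_linear commute)
  ultimately have "inner (sqrt_deriv2 y ?h ?h) ?h = inner (2 *\<^sub>R (((shifted_sqrt \<kappa> y - y) \<odot> k) \<odot> ((shifted_sqrt \<kappa> y + y) \<odot> k))) (double_inv y ?h)"
    by (simp add: double_inv_def mult_inv_self_adjoint[OF sum_shifted_sqrt_coercive])
  then show ?thesis by (simp add: double_inv_apply)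
qed

end

end

section \<open>The envelope of the barrier\<close>

lemma distance_split:
  fixes a b y :: "'a::real_inner"
  shows "(norm (a - y))\<^sup>2 = (norm (b - y))\<^sup>2 + 2 * inner (b - y) (a - b) + (norm (a - b))\<^sup>2"
  unfolding power2_norm_eq_inner by (simp add: inner_diff_left inner_diff_right inner_commute)

context trace_jordan_algebra
begin

abbreviation "barrier \<equiv> log_det_barrier jp e"
abbreviation "int_cone \<equiv> interior (cone_of_squares jp)"

context
  fixes \<mu> \<rho> :: real assumes \<mu>: "\<mu> > 0" and \<rho>: "\<rho> > 0"
begin

abbreviation (input) \<kappa> :: real where "\<kappa> \<equiv> \<mu> / \<rho>"

lemma kappa_pos: "\<kappa> > 0" using \<mu> \<rho> by simp

text \<open>
  The minimizer of \<open>prox_objective y\<close>: since \<open>prox y - dual_prox y = y\<close> and the two are inverse up to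
  the factor \<open>\<kappa>\<close>, the optimality condition \<open>\<rho> (z - y) = \<mu> z\<^bsup>-1\<^esup>\<close> holds.
\<close>

definition prox :: "'e \<Rightarrow> 'e" where "prox y = (1/2) *\<^sub>R (shifted_sqrt \<kappa> y + y)"

definition dual_prox :: "'e \<Rightarrow> 'e" where "dual_prox y = (1/2) *\<^sub>R (shifted_sqrt \<kappa> y - y)"

definition prox_objective :: "'e \<Rightarrow> 'e \<Rightarrow> real" where
  "prox_objective y z = \<mu> * barrier z + \<rho> / 2 * (norm (z - y))\<^sup>2"

text \<open>
  The Moreau envelope of the barrier.
\<close>

definition envelope :: "'e \<Rightarrow> real" where "envelope y = prox_objective y (prox y)"

lemma prox_minus: "prox y - y = dual_prox y"
proof -
  have "y = (1/2) *\<^sub>R y + (1/2) *\<^sub>R y" by (simp flip: scaleR_add_left)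
  then show ?thesis
    unfolding prox_def dual_prox_def scaleR_add_right scaleR_diff_right by (metis add_diff_cancel_right' add.assoc diff_diff_add)
qed

lemma prox_spec:
  obtains F f where "jordan_frame jp e F" "\<And>p. p \<in> F \<Longrightarrow> f p > 0"
    "prox y = spec F f" "dual_prox y = spec F (\<lambda>p. \<kappa> / f p)"
proof -
  obtain F l where F: "jordan_frame jp e F" "y = spec F l"
    "shifted_sqrt \<kappa> y = spec F (\<lambda>p. sqrt ((l p)\<^sup>2 + 4 * \<kappa>))"
    by (rule shifted_sqrt_spec)
  note cF = jordan_frame_complete[OF F(1)]
  define r where "r p = sqrt ((l p)\<^sup>2 + 4 * \<kappa>)" for p
  define f where "f p = 1/2 * (r p + l p)" for p
  have rl: "\<bar>l p\<bar> < r p" "(r p)\<^sup>2 = (l p)\<^sup>2 + 4 * \<kappa>" for p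
  proof -
    show "\<bar>l p\<bar> < r p" unfolding r_def using kappa_pos by (intro real_less_rsqrt) simp
    show "(r p)\<^sup>2 = (l p)\<^sup>2 + 4 * \<kappa>" unfolding r_def using kappa_pos by simp
  qed
  have pos: "f p > 0" for p using rl(1)[of p] by (simp add: f_def)
  have quotient: "1/2 * (r p - l p) = \<kappa> / f p" for p
  proof -
    have "(1/2 * (r p - l p)) * f p = \<kappa>"
      using rl(2)[of p] by (simp add: f_def power2_eq_square algebra_simps)
    then show ?thesis using pos[of p] by (simp only: nonzero_eq_divide_eq[OF less_imp_neq[OF pos, symmetric]])
  qed
  have "shifted_sqrt \<kappa> y + y = spec F (\<lambda>p. r p + l p)" "shifted_sqrt \<kappa> y - y = spec F (\<lambda>p. r p - l p)"
    unfolding F(3) r_def by (subst F(2), simp add: spec_add[OF cF] spec_diff[OF cF])+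
  then have "prox y = spec F f" "dual_prox y = spec F (\<lambda>p. 1/2 * (r p - l p))"
    by (simp_all only: prox_def dual_prox_def f_def[abs_def] spec_scale[OF cF])
  note this[unfolded quotient]
  with F(1) pos show thesis using that by blast
qed

lemma prox_in_interior: "prox y \<in> int_cone"
proof -
  obtain F f where "jordan_frame jp e F" "\<And>p. p \<in> F \<Longrightarrow> f p > 0" "prox y = spec F f"
    using prox_spec[of y] by blast
  then show ?thesis by (simp add: interior_cone_iff)
qed

text \<open>
  Add the tangent inequality of the barrier at \<open>prox y\<close> to the exact expansion of the quadratic term;
  the linear terms cancel by the optimality condition.
\<close>

lemma prox_minimal:
  assumes "z \<in> int_cone"
  shows "envelope y \<le> prox_objective y z"
proof -
  obtain F f where F: "jordan_frame jp e F" "\<And>p. p \<in> F \<Longrightarrow> f p > 0"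
    "prox y = spec F f" "dual_prox y = spec F (\<lambda>p. \<kappa> / f p)"
    using prox_spec[of y] by blast
  let ?g = "spec F (\<lambda>p. 1 / f p)"
  have g: "\<rho> *\<^sub>R dual_prox y = \<mu> *\<^sub>R ?g"
    using \<rho> by (simp add: F(4) spec_scale[OF jordan_frame_complete[OF F(1)]])
  have "\<mu> * barrier z \<ge> \<mu> * (barrier (prox y) - inner ?g (z - prox y))"
    using log_det_barrier_gradient_inequality[OF F(1,2) assms] \<mu> F(3) by simp
  moreover have "\<mu> * inner ?g (z - prox y) = \<rho> * inner (prox y - y) (z - prox y)"
    by (metis g inner_scaleR_left prox_minus)
  moreover have "\<rho> / 2 * (norm (z - y))\<^sup>2
      = \<rho> / 2 * (norm (prox y - y))\<^sup>2 + \<rho> * inner (prox y - y) (z - prox y) + \<rho> / 2 * (norm (z - prox y))\<^sup>2"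
    unfolding distance_split[of z y "prox y"] by (simp add: algebra_simps)
  moreover have "\<rho> / 2 * (norm (z - prox y))\<^sup>2 \<ge> 0" using \<rho> by simp
  ultimately show ?thesis
    unfolding envelope_def prox_objective_def right_diff_distrib by linarith
qed

lemma envelope_upper:
  "envelope y' - envelope y \<le> - \<rho> * inner (dual_prox y) (y' - y) + \<rho> / 2 * (norm (y' - y))\<^sup>2"
proof -
  have "envelope y' \<le> prox_objective y' (prox y)" by (rule prox_minimal[OF prox_in_interior])
  then have "envelope y' - envelope y \<le> \<rho> / 2 * ((norm (prox y - y'))\<^sup>2 - (norm (prox y - y))\<^sup>2)"
    unfolding envelope_def[of y] prox_objective_def by (simp add: right_diff_distrib)
  also have "(norm (prox y - y'))\<^sup>2 - (norm (prox y - y))\<^sup>2 = - 2 * inner (prox y - y) (y' - y) + (norm (y' - y))\<^sup>2"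
    unfolding power2_norm_eq_inner by (simp add: inner_diff_left inner_diff_right inner_commute)
  finally show ?thesis by (simp add: prox_minus algebra_simps)
qed

text \<open>
  Using the minimizer of one point as a competitor at the other bounds the increment from both
  sides; the bounds differ by \<open>o(\<parallel>y' - y\<parallel>)\<close> because \<open>dual_prox\<close> is continuous.
\<close>

lemma envelope_has_derivative:
  "(envelope has_derivative blinfun_apply (inner_blinfun (- \<rho> *\<^sub>R dual_prox y))) (at y)"
proof -
  define H where "H y' = \<rho> / 2 * norm (y' - y) + \<rho> * norm (dual_prox y' - dual_prox y)" for y'
  have "(dual_prox \<longlongrightarrow> dual_prox y) (at y)"
    unfolding dual_prox_def
    by (intro tendsto_scaleR tendsto_diff tendsto_const tendsto_ident_at isContD[OF isCont_shifted_sqrt[OF kappa_pos]])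
  then have "((\<lambda>y'. dual_prox y' - dual_prox y) \<longlongrightarrow> 0) (at y)" by (simp add: LIM_zero)
  then have "((\<lambda>y'. \<rho> * norm (dual_prox y' - dual_prox y)) \<longlongrightarrow> 0) (at y)"
    by (intro tendsto_mult_right_zero tendsto_norm_zero)
  moreover have "((\<lambda>y'. \<rho> / 2 * norm (y' - y)) \<longlongrightarrow> 0) (at y)"
    by (intro tendsto_mult_right_zero tendsto_norm_zero LIM_zero tendsto_ident_at)
  ultimately have H: "(H \<longlongrightarrow> 0) (at y)"
    unfolding H_def using tendsto_add_zero by blast
  show ?thesis
  proof (rule has_derivativeI_sandwich[OF zero_less_one _ _ H])
    fix y' assume "y' \<noteq> y"
    define d where "d = y' - y"
    have "envelope y' - envelope y + \<rho> * inner (dual_prox y) d \<le> H y' * norm d"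
    proof -
      have "0 \<le> \<rho> * norm (dual_prox y' - dual_prox y) * norm d" using \<rho> by simp
      then show ?thesis
        using envelope_upper[of y' y] by (simp add: H_def d_def power2_eq_square distrib_right)
    qed
    moreover have "- (H y' * norm d) \<le> envelope y' - envelope y + \<rho> * inner (dual_prox y) d"
    proof -
      have "inner (dual_prox y' - dual_prox y) d \<le> norm (dual_prox y' - dual_prox y) * norm d"
        by (rule norm_cauchy_schwarz)
      then have "\<rho> * inner (dual_prox y' - dual_prox y) d \<le> \<rho> * (norm (dual_prox y' - dual_prox y) * norm d)"
        using \<rho> by simp
      moreover have "envelope y - envelope y' \<le> \<rho> * inner (dual_prox y') d + \<rho> / 2 * (norm d)\<^sup>2"
        using envelope_upper[of y y'] by (simp add: d_def inner_diff_right norm_minus_commute right_diff_distrib)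
      ultimately show ?thesis
        by (simp add: H_def d_def[symmetric] inner_diff_left power2_eq_square algebra_simps)
    qed
    ultimately have "norm (envelope y' - envelope y + \<rho> * inner (dual_prox y) d) \<le> H y' * norm d"
      by (simp add: abs_le_iff)
    then show "norm (envelope y' - envelope y - inner_blinfun (- \<rho> *\<^sub>R dual_prox y) (y' - y)) / norm (y' - y) \<le> H y'"
      using \<open>y' \<noteq> y\<close> by (simp add: d_def divide_le_eq)
  qed (rule blinfun.bounded_linear_right)
qed

definition envelope2 :: "'e \<Rightarrow> 'e \<Rightarrow>\<^sub>L ('e \<Rightarrow>\<^sub>L real)" where
  "envelope2 y = (\<rho> / 2) *\<^sub>R (inner_blinfun o\<^sub>L (id_blinfun - sqrt_deriv \<kappa> y))"

definition envelope3 :: "'e \<Rightarrow> 'e \<Rightarrow>\<^sub>L ('e \<Rightarrow>\<^sub>L ('e \<Rightarrow>\<^sub>L real))" where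
  "envelope3 y = (- \<rho> / 2) *\<^sub>R (postcompose inner_blinfun o\<^sub>L sqrt_deriv2 \<kappa> y)"

lemma envelope_jet: "has_jet3 envelope (\<lambda>y. inner_blinfun (- \<rho> *\<^sub>R dual_prox y)) envelope2 envelope3"
  unfolding has_jet3_def
proof (intro conjI allI)
  fix y
  show "(envelope has_derivative blinfun_apply (inner_blinfun (- \<rho> *\<^sub>R dual_prox y))) (at y)"
    by (rule envelope_has_derivative)
  have "((\<lambda>y. - \<rho> *\<^sub>R dual_prox y) has_derivative (\<lambda>h. - \<rho> *\<^sub>R ((1/2) *\<^sub>R (sqrt_deriv \<kappa> y h - h)))) (at y)"
    unfolding dual_prox_def
    by (intro has_derivative_scaleR_right has_derivative_minus has_derivative_diff shifted_sqrt_has_derivative kappa_pos has_derivative_ident)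
  from bounded_linear.has_derivative[OF blinfun.bounded_linear_right this, of inner_blinfun]
  show "((\<lambda>y. inner_blinfun (- \<rho> *\<^sub>R dual_prox y)) has_derivative blinfun_apply (envelope2 y)) (at y)"
    by (rule has_derivative_eq_rhs)
      (simp add: envelope2_def fun_eq_iff blinfun.scaleR_left blinfun.diff_left blinfun.scaleR_right blinfun.diff_right
         blinfun.minus_right algebra_simps)
  have "((\<lambda>y. id_blinfun - sqrt_deriv \<kappa> y) has_derivative (\<lambda>h. 0 - sqrt_deriv2 \<kappa> y h)) (at y)"
    by (intro has_derivative_diff has_derivative_const sqrt_deriv_has_derivative kappa_pos)
  from has_derivative_scaleR_right[OF bounded_linear.has_derivative[OF blinfun.bounded_linear_right this, of "postcompose inner_blinfun"], of "\<rho> / 2"]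
  show "(envelope2 has_derivative blinfun_apply (envelope3 y)) (at y)"
    unfolding envelope2_def[abs_def] postcompose_apply
    by (rule has_derivative_eq_rhs)
      (simp add: envelope3_def fun_eq_iff blinfun.scaleR_left blinfun.minus_left bounded_bilinear.minus_right[OF bounded_bilinear_blinfun_compose])
next
  show "continuous_on UNIV envelope3"
    unfolding envelope3_def
    by (intro continuous_on_scaleR continuous_on_const continuous_on_blinfun_compose continuous_on_sqrt_deriv2 kappa_pos)
qed

lemma prox_plus: "prox y + dual_prox y = shifted_sqrt \<kappa> y"
  unfolding prox_def dual_prox_def scaleR_add_right[symmetric] by (simp flip: scaleR_2)

lemma direction_factor:
  obtains k where "h = shifted_sqrt \<kappa> y \<odot> k"
  using mult_inv(1)[OF shifted_sqrt_coercive[OF kappa_pos], of y h] by metis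

lemma envelope2_apply: "envelope2 y (shifted_sqrt \<kappa> y \<odot> k) h = \<rho> * inner (dual_prox y \<odot> k) h"
  by (simp add: envelope2_def dual_prox_def sqrt_deriv_apply[OF kappa_pos] blinfun.scaleR_left blinfun.diff_left
      blinfun.diff_right jp_diff_left inner_diff_left)

lemma envelope3_apply:
  fixes y k
  defines "h \<equiv> shifted_sqrt \<kappa> y \<odot> k"
  shows "envelope3 y h h h = - 2 * \<rho> * inner ((prox y \<odot> k) \<odot> (dual_prox y \<odot> k)) k"
proof -
  have "envelope3 y h h h = - \<rho> / 2 * inner (sqrt_deriv2 \<kappa> y h h) h"
    by (simp add: envelope3_def blinfun.scaleR_left blinfun.minus_left)
  also have "inner (sqrt_deriv2 \<kappa> y h h) h = 4 * inner ((prox y \<odot> k) \<odot> (dual_prox y \<odot> k)) k"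
    unfolding h_def sqrt_deriv2_inner[OF kappa_pos]
    by (simp add: prox_def dual_prox_def commute)
  finally show ?thesis by simp
qed

lemma prox_dual_commute: "inner (prox y \<odot> a) (dual_prox y \<odot> b) = inner (dual_prox y \<odot> a) (prox y \<odot> b)"
proof -
  obtain F f where F: "jordan_frame jp e F" "\<And>p. p \<in> F \<Longrightarrow> f p > 0"
    "prox y = spec F f" "dual_prox y = spec F (\<lambda>p. \<kappa> / f p)"
    using prox_spec[of y] by blast
  have "prox y \<odot> (dual_prox y \<odot> b) = dual_prox y \<odot> (prox y \<odot> b)"
    unfolding F(3,4) by (rule spec_commute[OF jordan_frame_complete[OF F(1)]])
  then show ?thesis by (simp add: inner_jp_left)
qed

text \<open>
  The constants come from \<open>\<kappa> = \<mu> / \<rho>\<close>: the factor \<open>2 \<rho> / sqrt \<kappa>\<close> equals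
  \<open>(2 / sqrt \<mu>) \<rho>\<^bsup>3/2\<^esup>\<close>.
\<close>

lemma envelope_cubic_bound:
  "\<bar>envelope3 y (shifted_sqrt \<kappa> y \<odot> k) (shifted_sqrt \<kappa> y \<odot> k) (shifted_sqrt \<kappa> y \<odot> k)\<bar>
    \<le> 2 / \<mu> powr (1/2) * (\<rho> * inner (prox y \<odot> k) (dual_prox y \<odot> k)) powr (3/2)"
  "inner (prox y \<odot> k) (dual_prox y \<odot> k) \<ge> 0"
proof -
  obtain F f where F: "jordan_frame jp e F" "\<And>p. p \<in> F \<Longrightarrow> f p > 0"
    "prox y = spec F f" "dual_prox y = spec F (\<lambda>p. \<kappa> / f p)"
    using prox_spec[of y] by blast
  let ?N = "inner (prox y \<odot> k) (dual_prox y \<odot> k)"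
  let ?T = "inner ((prox y \<odot> k) \<odot> (dual_prox y \<odot> k)) k"
  show N: "?N \<ge> 0"
    using scaled_cubic_bound(1)[where f = f, OF F(1,2) kappa_pos] by (simp add: F(3,4))
  have T: "sqrt \<kappa> * \<bar>?T\<bar> \<le> ?N powr (3/2)"
    using scaled_cubic_bound(2)[where f = f, OF F(1,2) kappa_pos] by (simp add: F(3,4))
  have "2 * \<rho> * \<bar>?T\<bar> = 2 / sqrt \<mu> * (\<rho> * sqrt \<rho>) * (sqrt \<kappa> * \<bar>?T\<bar>)"
    using \<mu> \<rho> by (simp add: real_sqrt_divide)
  also have "\<dots> \<le> 2 / sqrt \<mu> * (\<rho> * sqrt \<rho>) * ?N powr (3/2)"
    using \<mu> \<rho> by (intro mult_left_mono[OF T]) simp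
  also have "\<rho> * sqrt \<rho> = \<rho> powr (3/2)"
    using \<rho> powr_add[of \<rho> 1 "1/2"] by (simp add: powr_half_sqrt)
  finally show "\<bar>envelope3 y (shifted_sqrt \<kappa> y \<odot> k) (shifted_sqrt \<kappa> y \<odot> k) (shifted_sqrt \<kappa> y \<odot> k)\<bar>
    \<le> 2 / \<mu> powr (1/2) * (\<rho> * ?N) powr (3/2)"
    unfolding envelope3_apply using \<mu> \<rho> N by (simp add: abs_mult powr_mult powr_half_sqrt mult.assoc)
qed

lemma frame_positive_mult_injective:
  assumes F: "jordan_frame jp e F" and pos: "\<And>p. p \<in> F \<Longrightarrow> f p > 0" and zero: "spec F f \<odot> k = 0"
  shows "k = 0"
proof -
  note cF = jordan_frame_complete[OF F]
  have nonneg: "inner (p \<odot> k) k \<ge> 0" if "p \<in> F" for p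
    using that by (intro idempotent_inner_nonneg complete_idempotent[OF cF])
  have "(\<Sum>p\<in>F. f p * inner (p \<odot> k) k) = inner (spec F f \<odot> k) k"
    by (simp add: spec_apply[OF cF] inner_sum_left)
  then have "(\<Sum>p\<in>F. f p * inner (p \<odot> k) k) = 0" by (simp add: zero)
  then have "\<forall>p\<in>F. f p * inner (p \<odot> k) k = 0"
    using pos nonneg complete_finite[OF cF] by (subst (asm) sum_nonneg_eq_0_iff) (auto simp: less_imp_le)
  then have "(\<Sum>p\<in>F. inner (p \<odot> k) k) = 0"
    using pos by (intro sum.neutral) (auto simp: less_imp_neq[symmetric])
  then have "inner k k = 0"
    using complete_resolution[OF cF, of k] by (simp flip: inner_sum_left)
  then show ?thesis by simp
qed

lemma prox_mult_pos:
  assumes "shifted_sqrt \<kappa> y \<odot> k \<noteq> 0"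
  shows "inner (dual_prox y \<odot> k) (shifted_sqrt \<kappa> y \<odot> k) > 0"
    and "inner (prox y \<odot> k) (shifted_sqrt \<kappa> y \<odot> k) > 0"
proof -
  obtain F f where F: "jordan_frame jp e F" "\<And>p. p \<in> F \<Longrightarrow> f p > 0"
    "prox y = spec F f" "dual_prox y = spec F (\<lambda>p. \<kappa> / f p)"
    using prox_spec[of y] by blast
  have "k \<noteq> 0" using assms by auto
  moreover have "\<kappa> / f p > 0" if "p \<in> F" for p
    using F(2)[OF that] kappa_pos by (rule divide_pos_pos[rotated])
  ultimately have "prox y \<odot> k \<noteq> 0" "dual_prox y \<odot> k \<noteq> 0"
    using frame_positive_mult_injective[OF F(1), of f k] F(2)
      frame_positive_mult_injective[OF F(1), of "\<lambda>p. \<kappa> / f p" k]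
    unfolding F(3,4) by blast+
  moreover have "shifted_sqrt \<kappa> y \<odot> k = prox y \<odot> k + dual_prox y \<odot> k"
    unfolding jp_add_left[symmetric] by (simp add: prox_plus)
  ultimately show "inner (dual_prox y \<odot> k) (shifted_sqrt \<kappa> y \<odot> k) > 0"
    "inner (prox y \<odot> k) (shifted_sqrt \<kappa> y \<odot> k) > 0"
    using envelope_cubic_bound(2)[of y k]
    by (simp_all add: inner_add_right inner_commute[of "dual_prox y \<odot> k" "prox y \<odot> k"] add_nonneg_pos add_pos_nonneg)
qed

text \<open>
  Here \<open>a\<close> stands for the primal part of a direction and \<open>d\<close> for \<open>1/\<rho>\<close> times its dual part. With
  \<open>a = s j\<close> and \<open>d = s k\<close>, the saddle form exceeds \<open>\<rho> \<langle>z (j - k), w (j - k)\<rangle>\<close> exactly by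
  \<open>\<rho> \<parallel>w j + z k\<parallel>\<^sup>2\<close>, where \<open>z = prox y\<close> and \<open>w = dual_prox y\<close> commute as multiplication operators.
\<close>

lemma envelope_saddle:
  shows envelope2_nonneg: "envelope2 y a a \<ge> 0"
    and envelope2_pos: "a \<noteq> 0 \<Longrightarrow> envelope2 y a a > 0"
    and coenvelope2_nonneg: "\<rho> * (norm d)\<^sup>2 - envelope2 y d d \<ge> 0"
    and coenvelope2_pos: "d \<noteq> 0 \<Longrightarrow> \<rho> * (norm d)\<^sup>2 - envelope2 y d d > 0"
    and envelope3_saddle_bound: "\<bar>envelope3 y (a - d) (a - d) (a - d)\<bar> \<le> 2 / \<mu> powr (1/2)
      * (envelope2 y a a + (\<rho> * (norm d)\<^sup>2 - envelope2 y d d)) powr (3/2)"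
proof -
  obtain j where a: "a = shifted_sqrt \<kappa> y \<odot> j" by (rule direction_factor)
  obtain k where d: "d = shifted_sqrt \<kappa> y \<odot> k" by (rule direction_factor)
  let ?z = "prox y" and ?w = "dual_prox y"
  have split: "shifted_sqrt \<kappa> y \<odot> v = ?z \<odot> v + ?w \<odot> v" for v
    by (simp add: jp_add_left flip: prox_plus)
  have Ea: "envelope2 y a a = \<rho> * inner (?w \<odot> j) a"
    by (subst (1) a) (rule envelope2_apply)
  have Ed: "\<rho> * (norm d)\<^sup>2 - envelope2 y d d = \<rho> * inner (?z \<odot> k) d"
  proof -
    have "envelope2 y d d = \<rho> * inner (?w \<odot> k) d"
      by (subst (1) d) (rule envelope2_apply)
    moreover have "inner d d = inner (?z \<odot> k) d + inner (?w \<odot> k) d"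
      by (subst (1) d) (simp add: split inner_add_left)
    ultimately show ?thesis by (simp add: power2_norm_eq_inner algebra_simps)
  qed
  show pa: "envelope2 y a a > 0" if "a \<noteq> 0"
    using prox_mult_pos(1)[of y j] \<rho> that by (simp add: Ea flip: a)
  then show "envelope2 y a a \<ge> 0" by (cases "a = 0") (auto simp: blinfun.zero_right less_imp_le)
  show pd: "\<rho> * (norm d)\<^sup>2 - envelope2 y d d > 0" if "d \<noteq> 0"
    unfolding Ed using prox_mult_pos(2)[of y k] \<rho> that by (simp flip: d)
  then show "\<rho> * (norm d)\<^sup>2 - envelope2 y d d \<ge> 0" by (cases "d = 0") (auto simp: blinfun.zero_right less_imp_le)
  let ?N = "\<rho> * inner (?z \<odot> (j - k)) (?w \<odot> (j - k))"
  have "envelope2 y a a + (\<rho> * (norm d)\<^sup>2 - envelope2 y d d) = ?N + \<rho> * (norm (?w \<odot> j + ?z \<odot> k))\<^sup>2"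
    unfolding Ea Ed unfolding a d split power2_norm_eq_inner
    using prox_dual_commute[of y j k]
    by (simp add: jp_diff_right inner_add_left inner_add_right inner_diff_left inner_diff_right inner_commute algebra_simps)
  then have "?N \<le> envelope2 y a a + (\<rho> * (norm d)\<^sup>2 - envelope2 y d d)" using \<rho> by simp
  then have "?N powr (3/2) \<le> (envelope2 y a a + (\<rho> * (norm d)\<^sup>2 - envelope2 y d d)) powr (3/2)"
    using envelope_cubic_bound(2)[of y "j - k"] \<rho> by (intro powr_mono2) auto
  then have le: "2 / \<mu> powr (1/2) * ?N powr (3/2)
      \<le> 2 / \<mu> powr (1/2) * (envelope2 y a a + (\<rho> * (norm d)\<^sup>2 - envelope2 y d d)) powr (3/2)"
    by (intro mult_left_mono) auto
  have diff: "a - d = shifted_sqrt \<kappa> y \<odot> (j - k)" by (simp add: a d jp_diff_right)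
  show "\<bar>envelope3 y (a - d) (a - d) (a - d)\<bar> \<le> 2 / \<mu> powr (1/2)
      * (envelope2 y a a + (\<rho> * (norm d)\<^sup>2 - envelope2 y d d)) powr (3/2)"
    unfolding diff by (rule order_trans[OF envelope_cubic_bound(1) le])
qed

text \<open>
  Completing the square in \<open>z\<close> moves the multiplier \<open>s\<close> into the base point of the envelope.
\<close>

lemma reduced_BAL_envelope:
  "reduced_BAL jp e c xbar B \<rho> \<mu> (u, s)
    = inner c (xbar + B u) + (- 1 / (2 * \<rho>)) * (norm s)\<^sup>2 + envelope (xbar + B u - (1 / \<rho>) *\<^sub>R s)"
proof -
  define x where "x = xbar + B u"
  let ?y = "x - (1 / \<rho>) *\<^sub>R s"
  have objective: "inner c x + \<mu> * barrier z + inner s (z - x) + \<rho> / 2 * (norm (z - x))\<^sup>2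
      = inner c x + (- 1 / (2 * \<rho>)) * (norm s)\<^sup>2 + prox_objective ?y z" for z
  proof -
    have "z - ?y = (z - x) + (1 / \<rho>) *\<^sub>R s" by simp
    then have "(norm (z - ?y))\<^sup>2 = (norm (z - x))\<^sup>2 + 2 / \<rho> * inner s (z - x) + 1 / \<rho>\<^sup>2 * (norm s)\<^sup>2"
      using \<rho> unfolding power2_norm_eq_inner
      by (simp only: inner_add_left inner_add_right inner_scaleR_left inner_scaleR_right)
        (simp add: inner_commute[of "z - x" s] power2_eq_square add_divide_distrib)
    then show ?thesis using \<rho> by (simp add: prox_objective_def field_simps power2_eq_square)
  qed
  have "(LEAST v. \<exists>z \<in> int_cone. v = inner c x + \<mu> * barrier z + inner s (z - x) + \<rho> / 2 * (norm (z - x))\<^sup>2)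
      = inner c x + (- 1 / (2 * \<rho>)) * (norm s)\<^sup>2 + envelope ?y"
    unfolding objective
  proof (rule Least_equality)
    show "\<exists>z \<in> int_cone. inner c x + (- 1 / (2 * \<rho>)) * (norm s)\<^sup>2 + envelope ?y
        = inner c x + (- 1 / (2 * \<rho>)) * (norm s)\<^sup>2 + prox_objective ?y z"
      unfolding envelope_def using prox_in_interior by blast
  qed (use prox_minimal in auto)
  then show ?thesis by (simp add: reduced_BAL_def x_def Let_def)
qed

end
end

section \<open>The reduced barrier augmented Lagrangian\<close>

text \<open>
  The linear left inverse \<open>C\<close> is bounded below on the unit sphere of the range of \<open>B\<close>, by
  compactness.
\<close>

lemma inj_linear_bounded:
  fixes B :: "'f::real_normed_vector \<Rightarrow> 'e::euclidean_space"
  assumes B: "linear B" "inj B"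
  shows "bounded_linear B"
proof -
  obtain C where C: "linear C" "C \<circ> B = id"
    using linear_injective_left_inverse[OF B] by blast
  have CB: "C (B u) = u" for u using C(2) by (metis comp_apply id_apply)
  let ?S = "range B \<inter> sphere 0 1"
  have sub: "subspace (range B)" using B(1) by (rule linear_subspace_image) simp
  obtain m where m: "m > 0" "\<And>v. v \<in> ?S \<Longrightarrow> m \<le> norm (C v)"
  proof (cases "?S = {}")
    case True
    then show thesis using that[of 1] by auto
  next
    case False
    have "compact ?S" using sub by (simp add: closed_Int_compact closed_subspace)
    moreover have "continuous_on ?S (\<lambda>v. norm (C v))"
      using C(1) by (intro continuous_on_norm linear_continuous_on) (simp add: linear_conv_bounded_linear)
    ultimately obtain v where v: "v \<in> ?S" "\<And>u. u \<in> ?S \<Longrightarrow> norm (C v) \<le> norm (C u)"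
      using continuous_attains_inf[of ?S "\<lambda>v. norm (C v)"] False by blast
    have "C v \<noteq> 0"
    proof
      assume "C v = 0"
      moreover obtain u where "v = B u" using v(1) by blast
      ultimately have "v = 0" using CB linear_0[OF B(1)] by metis
      then show False using v(1) by simp
    qed
    then show thesis using that[of "norm (C v)"] v(2) by simp
  qed
  have "norm (B u) \<le> norm u * (1 / m)" for u
  proof (cases "B u = 0")
    case False
    have "B u /\<^sub>R norm (B u) \<in> ?S"
      using False sub by (simp add: subspace_scale)
    from m(2)[OF this] have "m \<le> norm u / norm (B u)"
      by (simp add: linear_scale[OF C(1)] CB divide_inverse mult.commute)
    then show ?thesis using False m(1) by (simp add: field_simps)
  qed (use m(1) in simp)
  then show ?thesis using B(1) by (intro bounded_linear_intro[of B "1 / m"]) (auto simp: linear_add linear_scale)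
qed

lemma has_jet3_self_concordant:
  assumes jet: "has_jet3 f G1 G2 G3"
    and pos: "\<And>x h. h \<noteq> 0 \<Longrightarrow> G2 x h h > 0"
    and bound: "\<And>x h. \<bar>G3 x h h h\<bar> \<le> 2 / \<alpha> powr (1/2) * G2 x h h powr (3/2)"
  shows "nondegenerate_self_concordant_on \<alpha> UNIV f"
proof -
  have "G2 x h h \<ge> 0" for x h
    using pos[of h x] by (cases "h = 0") (auto simp: blinfun.zero_right less_imp_le)
  then have "convex_on UNIV f" by (rule has_jet3_convex[OF jet])
  then show ?thesis
    using has_jet3_C3[OF jet] pos bound
    by (simp add: nondegenerate_self_concordant_on_def self_concordant_on_def
        has_jet3_D2[OF jet] has_jet3_D3[OF jet])
qed

context trace_jordan_algebra
begin

context
  fixes \<mu> \<rho> :: real and B :: "'f::real_inner \<Rightarrow> 'e" and c xbar :: 'e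
  assumes \<mu>: "\<mu> > 0" and \<rho>: "\<rho> > 0" and B: "linear B" "inj B"
begin

abbreviation (input) \<eta> where "\<eta> \<equiv> reduced_BAL jp e c xbar B \<rho> \<mu>"

text \<open>
  The last term of the second derivative comes from \<open>- \<parallel>s\<parallel>\<^sup>2 / (2 \<rho>)\<close>, rewritten in terms of
  \<open>(1 / \<rho>) s\<close> to match \<open>envelope_saddle\<close>.
\<close>

lemma reduced_BAL_jet:
  obtains H1 H2 H3 y where "has_jet3 \<eta> H1 H2 H3"
    "\<And>w h. H2 w h h = envelope2 \<mu> \<rho> (y w) (B (fst h) - (1 / \<rho>) *\<^sub>R snd h) (B (fst h) - (1 / \<rho>) *\<^sub>R snd h)
       - \<rho> * (norm ((1 / \<rho>) *\<^sub>R snd h))\<^sup>2"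
    "\<And>w h. H3 w h h h = envelope3 \<mu> \<rho> (y w) (B (fst h) - (1 / \<rho>) *\<^sub>R snd h)
       (B (fst h) - (1 / \<rho>) *\<^sub>R snd h) (B (fst h) - (1 / \<rho>) *\<^sub>R snd h)"
proof -
  have bB: "bounded_linear (\<lambda>w. B (fst w))"
    by (rule bounded_linear_compose[OF inj_linear_bounded[OF B] bounded_linear_fst])
  define L where "L = Blinfun (\<lambda>w :: 'f \<times> 'e. inner c (B (fst w)))"
  define M where "M = Blinfun (\<lambda>w :: 'f \<times> 'e. B (fst w) - (1 / \<rho>) *\<^sub>R snd w)"
  have L: "blinfun_apply L w = inner c (B (fst w))" for w
    unfolding L_def by (subst bounded_linear_Blinfun_apply)
      (auto intro!: bounded_linear_compose[OF bounded_linear_inner_right bB])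
  have M: "blinfun_apply M w = B (fst w) - (1 / \<rho>) *\<^sub>R snd w" for w
    unfolding M_def
    by (subst bounded_linear_Blinfun_apply) (intro bounded_linear_sub bB bounded_linear_compose[OF bounded_linear_scaleR_right bounded_linear_snd], rule refl)
  obtain N1 N2 N3 where N: "has_jet3 (\<lambda>w :: 'f \<times> 'e. (norm (0 + snd_blinfun w))\<^sup>2) N1 N2 N3"
    "\<And>w h k. N2 w h k = (2 *\<^sub>R inner_blinfun) (snd_blinfun h) (snd_blinfun k)"
    "\<And>w h. N3 w h h h = 0"
    by (rule has_jet3_affine[OF has_jet3_norm_square, of 0 snd_blinfun, unfolded blinfun.zero_left]) blast
  obtain E1 E2 E3 where E: "has_jet3 (\<lambda>w. envelope \<mu> \<rho> (xbar + M w)) E1 E2 E3"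
    "\<And>w h k. E2 w h k = envelope2 \<mu> \<rho> (xbar + M w) (M h) (M k)"
    "\<And>w h. E3 w h h h = envelope3 \<mu> \<rho> (xbar + M w) (M h) (M h) (M h)"
    by (rule has_jet3_affine[OF envelope_jet[OF \<mu> \<rho>], of xbar M]) blast
  note jet = has_jet3_add[OF has_jet3_add[OF has_jet3_linear[of "inner c xbar" L]
      has_jet3_scale[OF N(1), of "- 1 / (2 * \<rho>)"]] E(1)]
  have "\<eta> = (\<lambda>w. inner c xbar + L w + (- 1 / (2 * \<rho>)) * (norm (0 + snd_blinfun w))\<^sup>2 + envelope \<mu> \<rho> (xbar + M w))"
  proof
    fix w :: "'f \<times> 'e"
    show "\<eta> w = inner c xbar + L w + (- 1 / (2 * \<rho>)) * (norm (0 + snd_blinfun w))\<^sup>2 + envelope \<mu> \<rho> (xbar + M w)"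
      by (cases w) (simp add: reduced_BAL_envelope[OF \<mu> \<rho>] L M inner_add_right add_diff_eq)
  qed
  note jet[folded this]
  then show thesis
    by (rule that[where y = "\<lambda>w. xbar + M w"])
      (use \<rho> in \<open>simp_all add: N E M blinfun.add_left blinfun.diff_left blinfun.scaleR_left
        dot_square_norm power_divide power2_eq_square[of \<rho>]\<close>)
qed

text \<open>
  The two partial functions are the cases \<open>d = 0\<close> and \<open>a = 0\<close> of the saddle bound.
\<close>

lemma reduced_BAL_self_concordant:
  "nondegenerate_self_concordant_convex_concave \<mu> \<eta>"
  "nondegenerate_self_concordant_on \<mu> UNIV (\<lambda>u. \<eta> (u, s))"
  "nondegenerate_self_concordant_on \<mu> UNIV (\<lambda>s. - \<eta> (u, s))"
proof -
  obtain H1 H2 H3 y where jet: "has_jet3 \<eta> H1 H2 H3"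
    and H2: "\<And>w h. H2 w h h = envelope2 \<mu> \<rho> (y w) (B (fst h) - (1 / \<rho>) *\<^sub>R snd h) (B (fst h) - (1 / \<rho>) *\<^sub>R snd h)
       - \<rho> * (norm ((1 / \<rho>) *\<^sub>R snd h))\<^sup>2"
    and H3: "\<And>w h. H3 w h h h = envelope3 \<mu> \<rho> (y w) (B (fst h) - (1 / \<rho>) *\<^sub>R snd h)
       (B (fst h) - (1 / \<rho>) *\<^sub>R snd h) (B (fst h) - (1 / \<rho>) *\<^sub>R snd h)"
    by (rule reduced_BAL_jet) blast
  define I where "I = Blinfun (\<lambda>u :: 'f. (u, 0 :: 'e))"
  define J where "J = Blinfun (\<lambda>s :: 'e. (0 :: 'f, s))"
  have I: "blinfun_apply I u = (u, 0)" and J: "blinfun_apply J v = (0, v)" for u v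
    unfolding I_def J_def
    by (subst bounded_linear_Blinfun_apply; intro bounded_linear_Pair bounded_linear_ident bounded_linear_zero refl)+
  have B0: "B h = 0 \<longleftrightarrow> h = 0" "B 0 = 0" for h
    using B linear_0[OF B(1)] by (metis injD)+
  have D2u: "D2 (\<lambda>u. \<eta> (u, s)) u h = envelope2 \<mu> \<rho> (y (u, s)) (B h) (B h)"
    and SCu: "nondegenerate_self_concordant_on \<mu> UNIV (\<lambda>u. \<eta> (u, s))" for s u h
  proof -
    obtain G1 G2 G3 where G: "has_jet3 (\<lambda>u. \<eta> ((0, s) + I u)) G1 G2 G3"
      "\<And>w h k. G2 w h k = H2 ((0, s) + I w) (I h) (I k)"
      "\<And>w h. G3 w h h h = H3 ((0, s) + I w) (I h) (I h) (I h)"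
      by (rule has_jet3_affine[OF jet, of "(0, s)" I]) blast
    have G': "has_jet3 (\<lambda>u. \<eta> (u, s)) G1 G2 G3" using G(1) by (simp add: I)
    have G2: "G2 w h h = envelope2 \<mu> \<rho> (y (w, s)) (B h) (B h)"
      and G3: "G3 w h h h = envelope3 \<mu> \<rho> (y (w, s)) (B h) (B h) (B h)" for w h
      by (simp_all add: G(2,3) H2 H3 I)
    show "D2 (\<lambda>u. \<eta> (u, s)) u h = envelope2 \<mu> \<rho> (y (u, s)) (B h) (B h)"
      by (simp add: has_jet3_D2[OF G'] G2)
    show "nondegenerate_self_concordant_on \<mu> UNIV (\<lambda>u. \<eta> (u, s))"
    proof (rule has_jet3_self_concordant[OF G'])
      show "G2 w h h > 0" if "h \<noteq> 0" for w h
        using that B0 by (simp add: G2 envelope2_pos[OF \<mu> \<rho>])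
      show "\<bar>G3 w h h h\<bar> \<le> 2 / \<mu> powr (1/2) * G2 w h h powr (3/2)" for w h
        using envelope3_saddle_bound[OF \<mu> \<rho>, of "y (w, s)" "B h" 0] by (simp add: G2 G3 blinfun.zero_right)
    qed
  qed
  have D2s: "D2 (\<lambda>s. \<eta> (u, s)) s h
      = - (\<rho> * (norm ((1 / \<rho>) *\<^sub>R h))\<^sup>2 - envelope2 \<mu> \<rho> (y (u, s)) ((1 / \<rho>) *\<^sub>R h) ((1 / \<rho>) *\<^sub>R h))"
    and SCs: "nondegenerate_self_concordant_on \<mu> UNIV (\<lambda>s. - \<eta> (u, s))" for s u h
  proof -
    obtain G1 G2 G3 where G: "has_jet3 (\<lambda>s. \<eta> ((u, 0) + J s)) G1 G2 G3"
      "\<And>w h k. G2 w h k = H2 ((u, 0) + J w) (J h) (J k)"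
      "\<And>w h. G3 w h h h = H3 ((u, 0) + J w) (J h) (J h) (J h)"
      by (rule has_jet3_affine[OF jet, of "(u, 0)" J]) blast
    have G': "has_jet3 (\<lambda>s. \<eta> (u, s)) G1 G2 G3" using G(1) by (simp add: J)
    have G2: "G2 w h h = - (\<rho> * (norm ((1 / \<rho>) *\<^sub>R h))\<^sup>2
          - envelope2 \<mu> \<rho> (y (u, w)) ((1 / \<rho>) *\<^sub>R h) ((1 / \<rho>) *\<^sub>R h))"
      and G3: "G3 w h h h = envelope3 \<mu> \<rho> (y (u, w)) (0 - (1 / \<rho>) *\<^sub>R h) (0 - (1 / \<rho>) *\<^sub>R h) (0 - (1 / \<rho>) *\<^sub>R h)" for w h
      by (simp_all add: G(2,3) H2 H3 J B0 blinfun.minus_right blinfun.minus_left)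
    show "D2 (\<lambda>s. \<eta> (u, s)) s h
      = - (\<rho> * (norm ((1 / \<rho>) *\<^sub>R h))\<^sup>2 - envelope2 \<mu> \<rho> (y (u, s)) ((1 / \<rho>) *\<^sub>R h) ((1 / \<rho>) *\<^sub>R h))"
      by (simp only: has_jet3_D2[OF G'] G2)
    have N: "has_jet3 (\<lambda>s. - \<eta> (u, s)) (\<lambda>x. - G1 x) (\<lambda>x. - G2 x) (\<lambda>x. - G3 x)"
      using has_jet3_scale[OF G', of "-1"] by simp
    show "nondegenerate_self_concordant_on \<mu> UNIV (\<lambda>s. - \<eta> (u, s))"
    proof (rule has_jet3_self_concordant[OF N])
      show "(- G2 w) h h > 0" if "h \<noteq> 0" for w h
        using coenvelope2_pos[OF \<mu> \<rho>, of "(1 / \<rho>) *\<^sub>R h" "y (u, w)"] that \<rho> by (simp add: blinfun.minus_left G2)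
      show "\<bar>(- G3 w) h h h\<bar> \<le> 2 / \<mu> powr (1/2) * (- G2 w) h h powr (3/2)" for w h
        using envelope3_saddle_bound[OF \<mu> \<rho>, of "y (u, w)" 0 "(1 / \<rho>) *\<^sub>R h"]
        by (simp only: blinfun.minus_left G2 G3 blinfun.zero_right add_0_left minus_minus abs_minus_cancel)
    qed
  qed
  show "nondegenerate_self_concordant_on \<mu> UNIV (\<lambda>u. \<eta> (u, s))" by (rule SCu)
  show "nondegenerate_self_concordant_on \<mu> UNIV (\<lambda>s. - \<eta> (u, s))" by (rule SCs)
  have saddle: "saddle_form \<eta> w h = envelope2 \<mu> \<rho> (y w) (B (fst h)) (B (fst h))
      + (\<rho> * (norm ((1 / \<rho>) *\<^sub>R snd h))\<^sup>2 - envelope2 \<mu> \<rho> (y w) ((1 / \<rho>) *\<^sub>R snd h) ((1 / \<rho>) *\<^sub>R snd h))" for w h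
    unfolding saddle_form_def D2u D2s by simp
  have "convex_on UNIV (\<lambda>x. \<eta> (x, s))" "convex_on UNIV (\<lambda>s. - \<eta> (x, s))" for s x
    using SCu SCs by (auto simp: nondegenerate_self_concordant_on_def self_concordant_on_def)
  moreover have "\<bar>D3 \<eta> w h\<bar> \<le> 2 / \<mu> powr (1/2) * saddle_form \<eta> w h powr (3/2)" for w h
    unfolding saddle has_jet3_D3[OF jet] H3 by (rule envelope3_saddle_bound[OF \<mu> \<rho>])
  moreover have "saddle_form \<eta> w h > 0" if "h \<noteq> 0" for w h
  proof (cases "fst h = 0")
    case True
    then have "(1 / \<rho>) *\<^sub>R snd h \<noteq> 0" using that \<rho> by (auto simp: prod_eq_iff)
    then show ?thesis unfolding saddle by (intro add_nonneg_pos envelope2_nonneg[OF \<mu> \<rho>] coenvelope2_pos[OF \<mu> \<rho>])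
  next
    case False
    then have "B (fst h) \<noteq> 0" using B0 by simp
    then show ?thesis unfolding saddle by (intro add_pos_nonneg envelope2_pos[OF \<mu> \<rho>] coenvelope2_nonneg[OF \<mu> \<rho>])
  qed
  ultimately show "nondegenerate_self_concordant_convex_concave \<mu> \<eta>"
    unfolding nondegenerate_self_concordant_convex_concave_def self_concordant_convex_concave_def concave_on_def
    using has_jet3_C3[OF jet] by simp
qed

end
end

theorem theorem5:
  fixes jp :: "'e::euclidean_space \<Rightarrow> 'e \<Rightarrow> 'e" and e :: 'e and \<nu> :: nat
    and A :: "'e \<Rightarrow> real ^ 'm" and b :: "real ^ 'm" and c xbar :: 'e
    and B :: "'f::real_inner \<Rightarrow> 'e"
    and \<mu> \<rho> :: real
  assumes "euclidean_jordan_algebra jp e"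
    and "jordan_rank jp e = \<nu>"
    and "\<And>x y. inner x y = jordan_tr jp e (jp x y)"
    and "linear A" and "surj A"
    and "A xbar = b"
    and "\<exists>S :: 'f set. finite S \<and> span S = UNIV"
    and "dim (UNIV :: 'f set) = dim {x. A x = 0}"
    and "linear B" and "inj B"
    and "\<And>u. A (B u) = 0"
    and "\<And>u. adjoint B (B u) = u"
    and "\<mu> > 0" and "\<rho> > 0"
  shows "nondegenerate_self_concordant_convex_concave \<mu> (reduced_BAL jp e c xbar B \<rho> \<mu>)
    \<and> (\<forall>s. nondegenerate_self_concordant_on \<mu> UNIV (\<lambda>u. reduced_BAL jp e c xbar B \<rho> \<mu> (u, s)))
    \<and> (\<forall>u. nondegenerate_self_concordant_on \<mu> UNIV (\<lambda>s. - reduced_BAL jp e c xbar B \<rho> \<mu> (u, s)))"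
proof -
  interpret euclidean_jordan_algebra jp e by fact
  interpret trace_jordan_algebra jp e by unfold_locales (rule assms(3))
  show ?thesis
    using reduced_BAL_self_concordant[OF \<open>\<mu> > 0\<close> \<open>\<rho> > 0\<close> \<open>linear B\<close> \<open>inj B\<close>] by blast
qed

end
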